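(* Let $x\in\mathbb{R}$ be fixed, let $f$ and $k$ be probability densities on $\mathbb{R}$ with characteristic functions $\phi_f$ and $\phi_k$, let $w$ be a kernel with Fourier transform $\phi_w$, and let $(h_n)$ and $(\sigma_n)$ be sequences with $h_n>0$, $\sigma_n\ge 0$. Assume that: (i) $\phi_f$ is integrable; (ii) $\phi_k(t)\neq 0$ for all $t\in\mathbb{R}$ and $\phi_k$ has a bounded derivative; (iii) $w$ is symmetric, bounded and continuous; $\phi_w$ has support $[-1,1]$, $\phi_w(0)=1$, $\phi_w$ is differentiable and $|\phi_w(t)|\le 1$ for all $t$; (iv) $h_n\to 0$ and $nh_n\to\infty$ as $n\to\infty$; (v) $\sigma_n\to 0$ and $r_n=\sigma_n/h_n\to r$ as $n\to\infty$, where $0\le r<\infty$. Let $f_{nh_n}(x)$ be the deconvolution kernel density estimator based on $X_1,\ldots,X_n$, where $X_j=Y_j+\sigma_n Z_j$. Then $$\sqrt{nh_n}\,\bigl(f_{nh_n}(x)-\mathrm{E}[f_{nh_n}(x)]\bigr)\ \xrightarrow{\ \mathcal{D}\ }\ \mathcal{N}\left(0,\ f(x)\int_{-\infty}^{\infty}|w_r(u)|^2\,du\right)$$ as $n\to\infty$, where $$w_r(u)=\frac{1}{2\pi}\int_{-\infty}^{\infty}e^{-itu}\frac{\phi_w(t)}{\phi_k(rt)}\,dt .$$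
   Context: Model: for each $n$, one observes i.i.d. random variables $X_1,\ldots,X_n$ with $X_j=Y_j+\sigma_n Z_j$, where the $Y_j$ are i.i.d. with density $f$, the $Z_j$ are i.i.d. with known density $k$, and the $Y$'s and $Z$'s are independent. Here $\sigma_n$ depends on $n$. Conventions: $\phi_f(t)=\int e^{ity}f(y)\,dy$, $\phi_k(t)=\int e^{itz}k(z)\,dz$. The kernel $w$ is a real function on $\mathbb{R}$ (not necessarily nonnegative), with Fourier transform $\phi_w$, i.e. $w(x)=\frac{1}{2\pi}\int_{-\infty}^\infty e^{-itx}\phi_w(t)\,dt$. Since $\phi_f$ is integrable, $f$ is taken to be its continuous bounded version. The empirical characteristic function is $\phi_{emp}(t)=n^{-1}\sum_{j=1}^n e^{itX_j}$. The deconvolution kernel density estimator is $$f_{nh_n}(x)=\frac{1}{2\pi}\int_{-\infty}^{\infty}e^{-itx}\,\frac{\phi_w(h_nt)\,\phi_{emp}(t)}{\phi_k(\sigma_n t)}\,dt=\frac1n\sum_{j=1}^n\frac1{h_n}w_{r_n}\left(\frac{x-X_j}{h_n}\right),\qquad r_n=\frac{\sigma_n}{h_n},$$ where, for $s\ge 0$, $w_{s}(u)=\frac{1}{2\pi}\int_{-\infty}^{\infty}e^{-itu}\frac{\phi_w(t)}{\phi_k(st)}\,dt$. $\xrightarrow{\mathcal D}$ denotes convergence in distribution; $\mathcal N(m,v)$ is the normal distribution with mean $m$ and variance $v$ (a point mass at $m$ if $v=0$). *)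

theory Defs
  imports "HOL-Probability.Probability"
begin

definition prob_density :: "(real \<Rightarrow> real) \<Rightarrow> bool" where
  "prob_density g \<longleftrightarrow> (\<forall>y. 0 \<le> g y) \<and> integrable lborel g \<and> (LBINT y. g y) = 1"

definition char_of_density :: "(real \<Rightarrow> real) \<Rightarrow> real \<Rightarrow> complex" where
  "char_of_density g = char (density lborel (\<lambda>y. ennreal (g y)))"

definition emp_char :: "nat \<Rightarrow> (nat \<Rightarrow> real) \<Rightarrow> real \<Rightarrow> complex" where
  "emp_char n xs t = (\<Sum>j\<in>{1..n}. iexp (t * xs j)) / of_nat n"

definition deconv_kernel ::
    "(real \<Rightarrow> complex) \<Rightarrow> (real \<Rightarrow> complex) \<Rightarrow> real \<Rightarrow> real \<Rightarrow> complex" where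
  "deconv_kernel \<phi>w \<phi>k s u =
     complex_of_real (1 / (2 * pi)) * (CLBINT t. iexp (- (t * u)) * (\<phi>w t / \<phi>k (s * t)))"

text \<open>For a real kernel and a real error distribution the integral below is real
  (the integrand at \<open>-t\<close> is the conjugate of the integrand at \<open>t\<close>); \<open>Re\<close> only changes the type.\<close>

definition deconv_estimator ::
    "(real \<Rightarrow> complex) \<Rightarrow> (real \<Rightarrow> complex) \<Rightarrow> real \<Rightarrow> real \<Rightarrow> nat \<Rightarrow> (nat \<Rightarrow> real) \<Rightarrow> real \<Rightarrow> real" where
  "deconv_estimator \<phi>w \<phi>k \<sigma> h n xs x =
     Re (complex_of_real (1 / (2 * pi)) *
         (CLBINT t. iexp (- (t * x)) * (\<phi>w (h * t) * emp_char n xs t / \<phi>k (\<sigma> * t))))"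

text \<open>The second parameter is the variance, whereas \<^const>\<open>normal_density\<close> takes the
  standard deviation.\<close>

definition normal_law :: "real \<Rightarrow> real \<Rightarrow> real measure" where
  "normal_law m v =
     (if v = 0 then return borel m
      else density lborel (\<lambda>y. ennreal (normal_density m (sqrt v) y)))"

end

theory Submission
  imports Defs
begin

text \<open>
  After centring and rescaling, the estimator is a sum of i.i.d. variables
  \<open>(\<psi>\<^sub>n ((x - X\<^sub>j) / h\<^sub>n) - E) / sqrt (n h\<^sub>n)\<close> with \<open>\<psi>\<^sub>n = w\<^sub>s\<close> for \<open>s = \<sigma>\<^sub>n / h\<^sub>n\<close>. Since \<open>1 / \<phi>k\<close> is
  bounded on compact sets, these summands are bounded by \<open>C / sqrt (n h\<^sub>n)\<close>, which makes the Lindeberg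
  condition trivial; only the variance has to be computed. The substitution \<open>y = x - h u - \<sigma> z\<close>
  turns the second moment into the integral of \<open>\<psi>\<^sub>n\<^sup>2\<close> against averages of \<open>f\<close> that tend to \<open>f x\<close>
  boundedly, and \<open>\<psi>\<^sub>n\<close> converges in \<open>L\<^sup>2\<close> to \<open>w\<^sub>r\<close> because \<open>\<phi>w t / \<phi>k (s t)\<close> converges uniformly on
  \<open>[-1, 1]\<close>. The squared mean is negligible: in the mean the factor \<open>\<phi>k\<close> of the law of \<open>X\<^sub>j\<close> cancels,
  leaving \<open>O(h\<^sub>n)\<close>. The Fourier facts needed (an \<open>L\<^sup>2\<close> bound, uniqueness, boundedness of \<open>f\<close>) all
  come from one Gaussian smoothing identity.
\<close>

section \<open>Fourier transforms via Gaussian smoothing\<close>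

text \<open>The sign is that of the inversion formula and there is no factor
  \<open>1 / (2 * pi)\<close>: a kernel with Fourier transform \<open>g\<close> is
  \<open>fourier g\<close> divided by \<open>2 * pi\<close>, and the characteristic function of a
  density is its \<open>fourier\<close> at the reflected argument.\<close>

definition fourier :: "(real \<Rightarrow> complex) \<Rightarrow> real \<Rightarrow> complex" where
  "fourier g u = (CLBINT t. iexp (- (t * u)) * g t)"

lemma integrable_iexp_mult [intro]:
  assumes "integrable lborel g"
  shows "integrable lborel (\<lambda>t. iexp (a * t) * g t)"
    "integrable lborel (\<lambda>t. iexp (- (t * a)) * g t)"
proof -
  have [measurable]: "g \<in> borel_measurable borel"
    using assms by simp
  show "integrable lborel (\<lambda>t. iexp (a * t) * g t)"
    by (rule Bochner_Integration.integrable_bound[OF assms]) (auto simp: norm_mult)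
  show "integrable lborel (\<lambda>t. iexp (- (t * a)) * g t)"
    by (rule Bochner_Integration.integrable_bound[OF assms]) (auto simp: norm_mult)
qed

lemma fourier_measurable [measurable]:
  assumes [measurable]: "g \<in> borel_measurable borel"
  shows "fourier g \<in> borel_measurable borel"
proof -
  have "(\<lambda>u. CLBINT t. iexp (- (t * u)) * g t) \<in> borel_measurable borel"
    by (rule sigma_finite_measure.borel_measurable_lebesgue_integral)
       (auto intro: lborel.sigma_finite_measure_axioms)
  then show ?thesis unfolding fourier_def[abs_def] .
qed

lemma norm_fourier_le:
  assumes "integrable lborel g"
  shows "norm (fourier g u) \<le> (LBINT t. norm (g t))"
  unfolding fourier_def
  by (rule order_trans[OF integral_norm_bound]) (simp add: norm_mult)

lemma fourier_std_normal:
  "(CLBINT u. iexp (- (u * z)) * complex_of_real (std_normal_density u)) = complex_of_real (exp (- z\<^sup>2 / 2))"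
proof -
  have "(CLBINT u. iexp (- (u * z)) * complex_of_real (std_normal_density u))
      = (CLBINT u. std_normal_density u *\<^sub>R iexp ((- z) * u))"
    by (intro Bochner_Integration.integral_cong) (auto simp: scaleR_conv_of_real ac_simps)
  also have "\<dots> = char std_normal_distribution (- z)"
    unfolding char_def by (subst integral_density) auto
  finally show ?thesis
    by (simp add: char_std_normal_distribution)
qed

text \<open>Fubini moves the transform from \<open>G\<close> onto the Gaussian, whose own transform
  \<open>exp (- z\<^sup>2 / 2)\<close> is \<open>sqrt (2 * pi)\<close> times the standard normal
  density again.\<close>

lemma integral_std_normal_mult_fourier:
  assumes G: "integrable lborel G"
  shows "(CLBINT u. complex_of_real (std_normal_density u) * fourier G u)
    = complex_of_real (sqrt (2 * pi)) * (CLBINT z. complex_of_real (std_normal_density z) * G z)"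
proof -
  have [measurable]: "G \<in> borel_measurable borel"
    using G by simp
  let ?F = "\<lambda>u z. complex_of_real (std_normal_density u) * (iexp (- (z * u)) * G z)"
  have "integrable (lborel \<Otimes>\<^sub>M lborel) (\<lambda>(u, z). ?F u z)"
  proof (rule lborel_pair.Fubini_integrable)
    have "(\<lambda>u. LBINT z. norm (case (u, z) of (u, z) \<Rightarrow> ?F u z))
        = (\<lambda>u. std_normal_density u * (LBINT z. norm (G z)))"
      by (simp add: norm_mult)
    then show "integrable lborel (\<lambda>u. LBINT z. norm (case (u, z) of (u, z) \<Rightarrow> ?F u z))"
      by simp
    show "AE u in lborel. integrable lborel (\<lambda>z. case (u, z) of (u, z) \<Rightarrow> ?F u z)"
      using integrable_iexp_mult(2)[OF G] by (intro AE_I2) (simp only: prod.case integrable_mult_right)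
  qed measurable
  note Fub = lborel_pair.Fubini_integral[OF this]
  have "(CLBINT u. complex_of_real (std_normal_density u) * fourier G u) = (CLBINT u. CLBINT z. ?F u z)"
    unfolding fourier_def by simp
  also have "\<dots> = (CLBINT z. CLBINT u. ?F u z)"
    using Fub by simp
  also have "\<dots> = (CLBINT z. G z * (CLBINT u. iexp (- (u * z)) * complex_of_real (std_normal_density u)))"
    by (subst integral_mult_right_zero[symmetric]) (simp add: ac_simps)
  also have "\<dots> = (CLBINT z. complex_of_real (sqrt (2 * pi)) * (complex_of_real (std_normal_density z) * G z))"
    unfolding fourier_std_normal by (simp add: std_normal_density_def field_simps del: of_real_exp)
  finally show ?thesis by simp
qed

text \<open>The preceding identity for a translated and dilated \<open>g\<close>. On the left stands
  a Gaussian average of \<open>g\<close> around \<open>x\<close>, on the right an inversion integral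
  damped by a Gaussian, so that \<open>fourier g\<close> need not be integrable.\<close>

lemma gaussian_smoothing:
  assumes g: "integrable lborel g" and e: "0 < e"
  shows "(CLBINT z. complex_of_real (std_normal_density z) * g (x + e * z))
    = complex_of_real (1 / sqrt (2 * pi)) *
      (CLBINT v. complex_of_real (std_normal_density (e * v)) * (iexp (x * v) * fourier g v))"
proof -
  define G where "G z = g (x + e * z)" for z
  have G: "integrable lborel G"
    unfolding G_def using lborel_integrable_real_affine[OF g] e by simp
  \<comment> \<open>Translation by \<open>x\<close> contributes the phase, dilation by
    \<open>e\<close> the Jacobian and the rescaled frequency \<open>e * v\<close>.\<close>
  have *: "iexp (x * v) * fourier g v = complex_of_real e * fourier G (e * v)" for v
  proof -
    have "fourier g v = \<bar>e\<bar> *\<^sub>R (CLBINT z. iexp (- ((x + e * z) * v)) * g (x + e * z))"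
      unfolding fourier_def using e by (subst lborel_integral_real_affine[where c=e and t=x]) auto
    also have "(CLBINT z. iexp (- ((x + e * z) * v)) * g (x + e * z))
        = (CLBINT z. iexp (- (x * v)) * (iexp (- (z * (e * v))) * G z))"
      by (intro Bochner_Integration.integral_cong)
         (auto simp: G_def exp_add[symmetric] algebra_simps)
    also have "\<dots> = iexp (- (x * v)) * fourier G (e * v)"
      unfolding fourier_def by simp
    finally have "iexp (x * v) * fourier g v
        = (iexp (x * v) * iexp (- (x * v))) * (complex_of_real e * fourier G (e * v))"
      using e by (simp add: scaleR_conv_of_real ac_simps)
    also have "iexp (x * v) * iexp (- (x * v)) = 1"
      by (simp add: exp_add[symmetric])
    finally show ?thesis by simp
  qed
  have "(CLBINT u. complex_of_real (std_normal_density u) * fourier G u)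
    = \<bar>e\<bar> *\<^sub>R (CLBINT v. complex_of_real (std_normal_density (0 + e * v)) * fourier G (0 + e * v))"
    using e by (subst lborel_integral_real_affine[where c=e and t=0]) auto
  also have "\<dots> = (CLBINT v. complex_of_real e * (complex_of_real (std_normal_density (e * v)) * fourier G (e * v)))"
    using e by (simp add: scaleR_conv_of_real)
  also have "\<dots> = (CLBINT v. complex_of_real (std_normal_density (e * v)) * (iexp (x * v) * fourier g v))"
    unfolding * by (simp add: ac_simps)
  finally show ?thesis
    using integral_std_normal_mult_fourier[OF G] by (simp add: G_def field_simps)
qed

text \<open>By \<open>gaussian_smoothing\<close> all Gaussian averages of \<open>g\<close> vanish.
  Letting their width shrink recovers \<open>g x\<close>: continuity gives the pointwise limit,
  boundedness the majorant.\<close>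

lemma fourier_eq_0_imp_eq_0:
  assumes g: "integrable lborel g" and cont: "continuous_on UNIV g"
    and bound: "\<And>t. norm (g t) \<le> B" and zero: "\<And>u. fourier g u = 0"
  shows "g x = 0"
proof -
  have [measurable]: "g \<in> borel_measurable borel"
    using g by simp
  let ?e = "\<lambda>n. 1 / real (Suc n)"
  have "(\<lambda>n. CLBINT z. complex_of_real (std_normal_density z) * g (x + ?e n * z))
      \<longlonglongrightarrow> (CLBINT z. complex_of_real (std_normal_density z) * g x)"
  proof (rule integral_dominated_convergence[where w="\<lambda>z. std_normal_density z * B"])
    show "AE z in lborel. (\<lambda>n. complex_of_real (std_normal_density z) * g (x + ?e n * z))
        \<longlonglongrightarrow> complex_of_real (std_normal_density z) * g x"
    proof (intro AE_I2 tendsto_mult tendsto_const)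
      fix z :: real
      have "(\<lambda>n. x + ?e n * z) \<longlonglongrightarrow> x + 0 * z"
        by (intro tendsto_intros LIMSEQ_Suc[OF lim_1_over_n])
      then have "(\<lambda>n. x + ?e n * z) \<longlonglongrightarrow> x" by simp
      then show "(\<lambda>n. g (x + ?e n * z)) \<longlonglongrightarrow> g x"
        using cont by (auto simp: continuous_on_eq_continuous_at intro: isCont_tendsto_compose)
    qed
  qed (auto simp: norm_mult intro!: mult_left_mono bound)
  moreover have "(CLBINT z. complex_of_real (std_normal_density z) * g (x + ?e n * z)) = 0" for n
    by (subst gaussian_smoothing[OF g]) (auto simp: zero)
  moreover have "(CLBINT z. complex_of_real (std_normal_density z) * g x) = g x"
    by (simp add: integral_complex_of_real)
  ultimately show ?thesis
    by (simp add: LIMSEQ_const_iff)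
qed

lemma char_of_density_eq:
  assumes "prob_density g"
  shows "char_of_density g t = fourier (\<lambda>y. complex_of_real (g y)) (- t)"
  using assms unfolding char_of_density_def char_def fourier_def prob_density_def
  by (subst integral_density) (auto simp: scaleR_conv_of_real ac_simps intro!: Bochner_Integration.integral_cong)

text \<open>\<open>g\<close> is not known to be bounded beforehand, so the smoothing limit is taken with Fatou's lemma.\<close>

lemma density_bounded_by_char:
  assumes g: "prob_density g" and cont: "continuous_on UNIV g"
    and int: "integrable lborel (char_of_density g)"
  shows "g x \<le> (LBINT t. norm (char_of_density g t)) / (2 * pi)"
proof -
  let ?C = "(LBINT t. norm (char_of_density g t)) / (2 * pi)"
  have g_int: "integrable lborel (\<lambda>y. complex_of_real (g y))" and g0: "\<And>y. 0 \<le> g y"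
    and gi: "integrable lborel g"
    using g by (auto simp: prob_density_def)
  have [measurable]: "g \<in> borel_measurable borel"
    using gi by simp
  have fint: "integrable lborel (\<lambda>v. fourier (\<lambda>y. complex_of_real (g y)) v)"
    using lborel_integrable_real_affine[OF int, of "-1" 0] by (simp add: char_of_density_eq[OF g])
  have [measurable]: "fourier (\<lambda>y. complex_of_real (g y)) \<in> borel_measurable borel"
    by measurable
  have fnorm: "(LBINT v. norm (fourier (\<lambda>y. complex_of_real (g y)) v)) = 2 * pi * ?C"
    by (subst (2) lborel_integral_real_affine[where c="-1" and t=0]) (auto simp: char_of_density_eq[OF g])
  let ?e = "\<lambda>n. 1 / real (Suc n)"
  have std_le: "std_normal_density z \<le> 1 / sqrt (2 * pi)" for z
    by (auto simp: std_normal_density_def field_simps)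
  have int_e: "integrable lborel (\<lambda>z. std_normal_density z * g (x + e * z))" if "e > 0" for e
  proof (rule Bochner_Integration.integrable_bound)
    show "integrable lborel (\<lambda>z. 1 / sqrt (2 * pi) * g (x + e * z))"
      using lborel_integrable_real_affine[OF gi, of e x] that by auto
    show "AE z in lborel. norm (std_normal_density z * g (x + e * z)) \<le> norm (1 / sqrt (2 * pi) * g (x + e * z))"
      using mult_right_mono[OF std_le g0] g0 by (intro AE_I2) (auto simp: abs_mult)
  qed measurable
  \<comment> \<open>The Gaussian weight is at most \<open>1 / sqrt (2 * pi)\<close>; together with
    the equal prefactor in \<open>gaussian_smoothing\<close> this yields the
    \<open>1 / (2 * pi)\<close> of \<open>?C\<close>, uniformly in \<open>e\<close>.\<close>
  have bound: "(LBINT z. std_normal_density z * g (x + e * z)) \<le> ?C" if e: "e > 0" for e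
  proof -
    have "complex_of_real (LBINT z. std_normal_density z * g (x + e * z))
        = (CLBINT z. complex_of_real (std_normal_density z) * complex_of_real (g (x + e * z)))"
      by (simp flip: integral_complex_of_real)
    also have "\<dots> = complex_of_real (1 / sqrt (2 * pi)) * (CLBINT v. complex_of_real (std_normal_density (e * v))
         * (iexp (x * v) * fourier (\<lambda>y. complex_of_real (g y)) v))"
      by (rule gaussian_smoothing[OF g_int e])
    finally have "norm (complex_of_real (LBINT z. std_normal_density z * g (x + e * z)))
        = norm (complex_of_real (1 / sqrt (2 * pi)) * (CLBINT v. complex_of_real (std_normal_density (e * v))
         * (iexp (x * v) * fourier (\<lambda>y. complex_of_real (g y)) v)))"
      by (rule arg_cong)
    moreover have "\<bar>1 / sqrt (2 * pi)\<bar> = 1 / sqrt (2 * pi)"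
      by (intro abs_of_nonneg) auto
    ultimately have "\<bar>LBINT z. std_normal_density z * g (x + e * z)\<bar>
        = 1 / sqrt (2 * pi) * norm (CLBINT v. complex_of_real (std_normal_density (e * v))
         * (iexp (x * v) * fourier (\<lambda>y. complex_of_real (g y)) v))"
      by (simp only: norm_mult norm_of_real)
    also have "\<dots> \<le> 1 / sqrt (2 * pi) * (LBINT v. 1 / sqrt (2 * pi) * norm (fourier (\<lambda>y. complex_of_real (g y)) v))"
    proof (intro mult_left_mono Bochner_Integration.integral_norm_bound_integral)
      show "integrable lborel (\<lambda>v. 1 / sqrt (2 * pi) * norm (fourier (\<lambda>y. complex_of_real (g y)) v))"
        using fint by simp
      show le: "norm (complex_of_real (std_normal_density (e * v)) * (iexp (x * v) * fourier (\<lambda>y. complex_of_real (g y)) v))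
          \<le> 1 / sqrt (2 * pi) * norm (fourier (\<lambda>y. complex_of_real (g y)) v)" for v
        using mult_right_mono[OF std_le[of "e * v"] norm_ge_zero[of "fourier (\<lambda>y. complex_of_real (g y)) v"]]
        by (simp add: norm_mult)
      show "integrable lborel (\<lambda>v. complex_of_real (std_normal_density (e * v)) * (iexp (x * v) * fourier (\<lambda>y. complex_of_real (g y)) v))"
      proof (rule Bochner_Integration.integrable_bound)
        show "integrable lborel (\<lambda>v. 1 / sqrt (2 * pi) * norm (fourier (\<lambda>y. complex_of_real (g y)) v))"
          using fint by simp
        show "AE v in lborel. norm (complex_of_real (std_normal_density (e * v)) * (iexp (x * v) * fourier (\<lambda>y. complex_of_real (g y)) v))
            \<le> norm (1 / sqrt (2 * pi) * norm (fourier (\<lambda>y. complex_of_real (g y)) v))"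
          by (intro AE_I2 order_trans[OF le]) (simp only: real_norm_def abs_ge_self)
      qed measurable
    qed auto
    also have "\<dots> = (1 / sqrt (2 * pi) * (1 / sqrt (2 * pi))) * (2 * pi * ?C)"
      using fnorm by (simp del: real_sqrt_mult)
    also have "(1 / sqrt (2 * pi) * (1 / sqrt (2 * pi))) = 1 / (2 * pi)"
      by simp
    finally show ?thesis by simp
  qed
  \<comment> \<open>\<open>g x\<close> is written as the Gaussian average of a constant, and the
    constant integrand as the pointwise limit of the integrands just bounded.\<close>
  have "ennreal (g x) = (\<integral>\<^sup>+ z. ennreal (std_normal_density z * g x) \<partial>lborel)"
    by (subst nn_integral_eq_integral) (auto simp: g0)
  also have "\<dots> = (\<integral>\<^sup>+ z. liminf (\<lambda>n. ennreal (std_normal_density z * g (x + ?e n * z))) \<partial>lborel)"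
  proof (intro nn_integral_cong)
    fix z :: real
    have "(\<lambda>n. x + ?e n * z) \<longlonglongrightarrow> x + 0 * z"
      by (intro tendsto_intros LIMSEQ_Suc[OF lim_1_over_n])
    then have "(\<lambda>n. x + ?e n * z) \<longlonglongrightarrow> x" by simp
    then have "(\<lambda>n. g (x + ?e n * z)) \<longlonglongrightarrow> g x"
      using cont by (auto simp: continuous_on_eq_continuous_at intro: isCont_tendsto_compose)
    then have "(\<lambda>n. ennreal (std_normal_density z * g (x + ?e n * z))) \<longlonglongrightarrow> ennreal (std_normal_density z * g x)"
      by (intro tendsto_intros)
    then show "ennreal (std_normal_density z * g x) = liminf (\<lambda>n. ennreal (std_normal_density z * g (x + ?e n * z)))"
      by (simp add: lim_imp_Liminf)
  qed
  also have "\<dots> \<le> liminf (\<lambda>n. \<integral>\<^sup>+ z. ennreal (std_normal_density z * g (x + ?e n * z)) \<partial>lborel)"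
    by (rule nn_integral_liminf) measurable
  also have "\<dots> \<le> ennreal ?C"
  proof (rule Liminf_le)
    show "\<forall>\<^sub>F n in sequentially. (\<integral>\<^sup>+ z. ennreal (std_normal_density z * g (x + ?e n * z)) \<partial>lborel) \<le> ennreal ?C"
    proof (intro always_eventually allI)
      fix n
      have e: "?e n > 0" by simp
      show "(\<integral>\<^sup>+ z. ennreal (std_normal_density z * g (x + ?e n * z)) \<partial>lborel) \<le> ennreal ?C"
        using bound[OF e] by (subst nn_integral_eq_integral[OF int_e[OF e]]) (auto simp: g0 intro: ennreal_leI)
    qed
  qed simp
  finally show ?thesis
    by (subst (asm) ennreal_le_iff) auto
qed

text \<open>The constant is not sharp (Plancherel would give \<open>2 * pi\<close> times the squared \<open>L\<^sup>2\<close> norm); crudely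
  bounding the Gaussian average of \<open>g\<close> by \<open>A\<close> is enough below.\<close>

lemma fourier_square_integrable:
  assumes [measurable]: "g \<in> borel_measurable borel"
    and bound: "\<And>t. norm (g t) \<le> A" and supp: "\<And>t. 1 < \<bar>t\<bar> \<Longrightarrow> g t = 0"
  shows "integrable lborel (\<lambda>u. (norm (fourier g u))\<^sup>2)" (is ?int)
    and "(LBINT u. (norm (fourier g u))\<^sup>2) \<le> 4 * pi * A\<^sup>2" (is ?le)
proof -
  have [measurable]: "cnj \<in> borel_measurable borel"
    by (intro borel_measurable_continuous_onI continuous_intros)
  have A: "0 \<le> A"
    using bound[of 0] norm_ge_zero order_trans by blast
  have dom: "integrable lborel (\<lambda>t::real. A * indicator {-1..1} t)"
    by simp
  have dom_le: "norm (g t) \<le> A * indicator {-1..1} t" for t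
    using bound[of t] supp[of t] by (auto simp: indicator_def abs_le_iff not_le)
  have g: "integrable lborel g"
    by (rule Bochner_Integration.integrable_bound[OF dom]) (use dom_le A in \<open>auto\<close>)
  have ng: "(LBINT t. norm (g t)) \<le> 2 * A"
  proof -
    have "(LBINT t. norm (g t)) \<le> (LBINT t. A * indicator {-1..1} (t::real))"
      by (intro integral_mono dom g integrable_norm dom_le)
    then show ?thesis by simp
  qed
  have cg: "integrable lborel (\<lambda>t. cnj (g t))"
    using g by simp
  have std_le: "std_normal_density z \<le> 1 / sqrt (2 * pi)" for z
    by (auto simp: std_normal_density_def field_simps)
  have F_le: "norm (fourier g v) \<le> 2 * A" for v
    using norm_fourier_le[OF g] ng order_trans by blast
  have cnj_fourier: "cnj (fourier g v) = (CLBINT y. iexp (y * v) * cnj (g y))" for v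
    unfolding fourier_def by (subst Bochner_Integration.integral_cnj[symmetric]) (auto simp: exp_cnj)
  have int_std: "integrable lborel (\<lambda>v. std_normal_density (e * v))" if "e > 0" for e
    using lborel_integrable_real_affine[OF integrable_normal_density[of 1 0], of e 0] that by simp
  have weighted_int: "integrable lborel (\<lambda>v. std_normal_density (e * v) * (norm (fourier g v))\<^sup>2)" if e: "e > 0" for e
  proof (rule Bochner_Integration.integrable_bound)
    show "integrable lborel (\<lambda>v. std_normal_density (e * v) * (2 * A)\<^sup>2)"
      using int_std[OF e] by simp
    show "AE v in lborel. norm (std_normal_density (e * v) * (norm (fourier g v))\<^sup>2)
        \<le> norm (std_normal_density (e * v) * (2 * A)\<^sup>2)"
      unfolding norm_mult using power_mono[OF F_le norm_ge_zero, of _ 2]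
      by (intro AE_I2 mult_left_mono) auto
  qed measurable
  \<comment> \<open>With the Gaussian damping Fubini applies. Writing the square as
    \<open>fourier g v * cnj (fourier g v)\<close> and expanding the second factor over
    \<open>y\<close>, the \<open>v\<close>-integral becomes a Gaussian average \<open>?S y\<close>
    of \<open>g\<close>, at most \<open>A\<close> in norm; integrating it against
    \<open>cnj (g y)\<close> costs the norm integral of \<open>g\<close>, at most
    \<open>2 * A\<close> since the support has length 2.\<close>
  have weighted_le: "(LBINT v. std_normal_density (e * v) * (norm (fourier g v))\<^sup>2) \<le> sqrt (2 * pi) * (2 * A\<^sup>2)"
    if e: "e > 0" for e
  proof -
    let ?H = "\<lambda>v y. complex_of_real (std_normal_density (e * v)) * (fourier g v * (iexp (y * v) * cnj (g y)))"
    let ?S = "\<lambda>y. CLBINT z. complex_of_real (std_normal_density z) * g (y + e * z)"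
    have ge: "integrable lborel (\<lambda>z. g (y + e * z))" for y
      using lborel_integrable_real_affine[OF g, of e y] e by simp
    have S_le: "norm (?S y) \<le> A" for y
    proof -
      have "norm (?S y) \<le> (LBINT z. std_normal_density z * A)"
      proof (rule Bochner_Integration.integral_norm_bound_integral)
        show "integrable lborel (\<lambda>z. complex_of_real (std_normal_density z) * g (y + e * z))"
        proof (rule Bochner_Integration.integrable_bound)
          show "integrable lborel (\<lambda>z. std_normal_density z * A)"
            by simp
          show "AE z in lborel. norm (complex_of_real (std_normal_density z) * g (y + e * z)) \<le> norm (std_normal_density z * A)"
            using A by (intro AE_I2) (auto simp: norm_mult abs_mult intro!: mult_left_mono bound)
        qed measurable
      qed (auto simp: norm_mult intro!: mult_left_mono bound)
      then show ?thesis by simp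
    qed
    have S_meas [measurable]: "?S \<in> borel_measurable borel"
    proof -
      have "?S \<in> borel_measurable lborel"
        by (rule lborel.borel_measurable_lebesgue_integral) measurable
      then show ?thesis by simp
    qed
    have intH: "integrable (lborel \<Otimes>\<^sub>M lborel) (\<lambda>(v, y). ?H v y)"
    proof (rule lborel_pair.Fubini_integrable)
      have "(\<lambda>v. LBINT y. norm (case (v, y) of (v, y) \<Rightarrow> ?H v y))
          = (\<lambda>v. std_normal_density (e * v) * norm (fourier g v) * (LBINT y. norm (g y)))"
        by (simp add: norm_mult mult.assoc)
      moreover have "integrable lborel (\<lambda>v. std_normal_density (e * v) * norm (fourier g v))"
        by (rule Bochner_Integration.integrable_bound[OF integrable_mult_left[OF int_std[OF e], of "2 * A"]])
           (use F_le A in \<open>auto simp: abs_mult intro!: AE_I2 mult_left_mono\<close>)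
      ultimately show "integrable lborel (\<lambda>v. LBINT y. norm (case (v, y) of (v, y) \<Rightarrow> ?H v y))"
        by simp
      show "AE v in lborel. integrable lborel (\<lambda>y. case (v, y) of (v, y) \<Rightarrow> ?H v y)"
        using integrable_iexp_mult(1)[OF cg] by (intro AE_I2) (simp add: mult.commute)
    qed measurable
    have "complex_of_real (LBINT v. std_normal_density (e * v) * (norm (fourier g v))\<^sup>2)
        = (CLBINT v. complex_of_real (std_normal_density (e * v)) * (fourier g v * cnj (fourier g v)))"
      by (simp add: complex_norm_square[symmetric] flip: integral_complex_of_real)
    also have "\<dots> = (CLBINT v. CLBINT y. ?H v y)"
      unfolding cnj_fourier by simp
    also have "\<dots> = (CLBINT y. CLBINT v. ?H v y)"
      using lborel_pair.Fubini_integral[OF intH] by simp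
    also have "\<dots> = (CLBINT y. cnj (g y) * (CLBINT v. complex_of_real (std_normal_density (e * v)) * (iexp (y * v) * fourier g v)))"
      by (subst integral_mult_right_zero[symmetric]) (simp add: ac_simps)
    also have "\<dots> = (CLBINT y. complex_of_real (sqrt (2 * pi)) * (cnj (g y) * ?S y))"
      by (subst gaussian_smoothing[OF g e]) (simp add: ac_simps)
    finally have eq: "complex_of_real (LBINT v. std_normal_density (e * v) * (norm (fourier g v))\<^sup>2)
      = complex_of_real (sqrt (2 * pi)) * (CLBINT y. cnj (g y) * ?S y)"
      by simp
    have "norm (CLBINT y. cnj (g y) * ?S y) \<le> (LBINT y. norm (g y) * A)"
    proof (rule Bochner_Integration.integral_norm_bound_integral)
      show "integrable lborel (\<lambda>y. norm (g y) * A)"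
        using g by simp
      show le: "norm (cnj (g y) * ?S y) \<le> norm (g y) * A" for y
        unfolding norm_mult complex_mod_cnj by (intro mult_left_mono S_le) simp
      show "integrable lborel (\<lambda>y. cnj (g y) * ?S y)"
      proof (rule Bochner_Integration.integrable_bound)
        show "integrable lborel (\<lambda>y. norm (g y) * A)"
          using g by simp
        show "AE y in lborel. norm (cnj (g y) * ?S y) \<le> norm (norm (g y) * A)"
          by (intro AE_I2 order_trans[OF le]) (simp only: real_norm_def abs_ge_self)
        show "(\<lambda>y. cnj (g y) * ?S y) \<in> borel_measurable lborel"
          by (intro borel_measurable_times) (use S_meas in simp_all)
      qed
    qed
    also have "\<dots> \<le> 2 * A\<^sup>2"
      using mult_right_mono[OF ng A] by (simp add: power2_eq_square)
    finally have "sqrt (2 * pi) * norm (CLBINT y. cnj (g y) * ?S y) \<le> sqrt (2 * pi) * (2 * A\<^sup>2)"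
      by (intro mult_left_mono) auto
    moreover have "\<bar>LBINT v. std_normal_density (e * v) * (norm (fourier g v))\<^sup>2\<bar> = sqrt (2 * pi) * norm (CLBINT y. cnj (g y) * ?S y)"
      using arg_cong[OF eq, of norm] by (simp only: norm_mult norm_of_real) simp
    ultimately show ?thesis by linarith
  qed
  let ?e = "\<lambda>n. 1 / real (Suc n)"
  \<comment> \<open>The standard normal density is \<open>1 / sqrt (2 * pi)\<close> at 0, so the
    extra factor makes the weight tend to 1, as Fatou's lemma requires. Two factors
    \<open>sqrt (2 * pi)\<close> and the earlier 2 make up \<open>4 * pi\<close>.\<close>
  let ?h = "\<lambda>n v. sqrt (2 * pi) * (std_normal_density (?e n * v) * (norm (fourier g v))\<^sup>2)"
  have "(\<integral>\<^sup>+ v. ennreal ((norm (fourier g v))\<^sup>2) \<partial>lborel) = (\<integral>\<^sup>+ v. liminf (\<lambda>n. ennreal (?h n v)) \<partial>lborel)"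
  proof (intro nn_integral_cong)
    fix v :: real
    have "(\<lambda>n. ?h n v) = (\<lambda>n. exp (- (?e n * v)\<^sup>2 / 2) * (norm (fourier g v))\<^sup>2)"
      by (auto simp: std_normal_density_def)
    also have "\<dots> \<longlonglongrightarrow> exp (- (0 * v)\<^sup>2 / 2) * (norm (fourier g v))\<^sup>2"
      by (intro tendsto_intros LIMSEQ_Suc[OF lim_1_over_n]) auto
    finally have "(\<lambda>n. ?h n v) \<longlonglongrightarrow> (norm (fourier g v))\<^sup>2" by simp
    then show "ennreal ((norm (fourier g v))\<^sup>2) = liminf (\<lambda>n. ennreal (?h n v))"
      using lim_imp_Liminf[OF _ tendsto_ennrealI] by (metis sequentially_bot)
  qed
  also have "\<dots> \<le> liminf (\<lambda>n. \<integral>\<^sup>+ v. ennreal (?h n v) \<partial>lborel)"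
    by (rule nn_integral_liminf) measurable
  also have "\<dots> \<le> ennreal (4 * pi * A\<^sup>2)"
  proof (rule Liminf_le)
    show "\<forall>\<^sub>F n in sequentially. (\<integral>\<^sup>+ v. ennreal (?h n v) \<partial>lborel) \<le> ennreal (4 * pi * A\<^sup>2)"
    proof (intro always_eventually allI)
      fix n
      have e: "?e n > 0" by simp
      have "(\<integral>\<^sup>+ v. ennreal (?h n v) \<partial>lborel) = ennreal (LBINT v. ?h n v)"
        by (rule nn_integral_eq_integral) (use weighted_int[OF e] in auto)
      also have "(LBINT v. ?h n v) \<le> sqrt (2 * pi) * (sqrt (2 * pi) * (2 * A\<^sup>2))"
        unfolding integral_mult_right_zero by (intro mult_left_mono weighted_le[OF e]) auto
      also have "sqrt (2 * pi) * (sqrt (2 * pi) * (2 * A\<^sup>2)) = 4 * pi * A\<^sup>2"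
        by (simp flip: mult.assoc)
      finally show "(\<integral>\<^sup>+ v. ennreal (?h n v) \<partial>lborel) \<le> ennreal (4 * pi * A\<^sup>2)"
        by (simp add: ennreal_leI)
    qed
  qed simp
  finally have *: "(\<integral>\<^sup>+ v. ennreal ((norm (fourier g v))\<^sup>2) \<partial>lborel) \<le> ennreal (4 * pi * A\<^sup>2)" .
  show ?int
    by (rule integrableI_bounded) (use * in \<open>auto intro: le_less_trans\<close>)
  then show ?le
    using * by (subst (asm) nn_integral_eq_integral) auto
qed

section \<open>The deconvolution kernel\<close>

text \<open>The two conjugation assumptions express that the kernel and the error law are real; they
  make \<open>deconv_kernel\<close> real-valued.\<close>

locale deconvolution =
  fixes \<phi>w \<phi>k :: "real \<Rightarrow> complex"
  assumes \<phi>w_cont: "continuous_on UNIV \<phi>w"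
    and \<phi>w_supp: "\<And>t. 1 < \<bar>t\<bar> \<Longrightarrow> \<phi>w t = 0"
    and \<phi>w_le: "\<And>t. norm (\<phi>w t) \<le> 1"
    and \<phi>w_cnj: "\<And>t. \<phi>w (- t) = cnj (\<phi>w t)"
    and \<phi>k_cont: "continuous_on UNIV \<phi>k"
    and \<phi>k_nonzero: "\<And>t. \<phi>k t \<noteq> 0"
    and \<phi>k_cnj: "\<And>t. \<phi>k (- t) = cnj (\<phi>k t)"
begin

abbreviation "W \<equiv> deconv_kernel \<phi>w \<phi>k"

definition Q :: "real \<Rightarrow> real \<Rightarrow> complex" where
  "Q s t = \<phi>w t / \<phi>k (s * t)"

lemma W_eq: "W s u = complex_of_real (1 / (2 * pi)) * fourier (Q s) u"
  by (simp add: deconv_kernel_def fourier_def Q_def)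

lemma \<phi>w_measurable [measurable]: "\<phi>w \<in> borel_measurable borel"
  using \<phi>w_cont by (rule borel_measurable_continuous_onI)

lemma \<phi>k_measurable [measurable]: "\<phi>k \<in> borel_measurable borel"
  using \<phi>k_cont by (rule borel_measurable_continuous_onI)

lemma Q_measurable [measurable]: "Q s \<in> borel_measurable borel"
  unfolding Q_def[abs_def] by measurable

lemma Q_supp: "1 < \<bar>t\<bar> \<Longrightarrow> Q s t = 0"
  by (simp add: Q_def \<phi>w_supp)

text \<open>\<open>1 / \<phi>k\<close> is continuous, hence bounded on \<open>[-R, R]\<close>, and
  the support of \<open>\<phi>w\<close> keeps \<open>s * t\<close> in that interval. Uniformity in
  \<open>s\<close> is needed because the ratio \<open>\<sigma> n / h n\<close> changes with
  \<open>n\<close>.\<close>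

lemma Q_bound:
  obtains K where "0 < K" "\<And>s t. \<bar>s\<bar> \<le> R \<Longrightarrow> norm (Q s t) \<le> K"
proof -
  have "compact ((\<lambda>t. 1 / \<phi>k t) ` {-R..R})"
    by (intro compact_continuous_image continuous_intros continuous_on_subset[OF \<phi>k_cont])
       (auto simp: \<phi>k_nonzero)
  then obtain K where K: "0 < K" "\<And>t. t \<in> {-R..R} \<Longrightarrow> norm (1 / \<phi>k t) \<le> K"
    using compact_imp_bounded bounded_pos by (metis (no_types, lifting) image_eqI)
  have "norm (Q s t) \<le> K" if s: "\<bar>s\<bar> \<le> R" for s t
  proof (cases "\<bar>t\<bar> \<le> 1")
    case True
    then have "\<bar>s * t\<bar> \<le> R * 1"
      unfolding abs_mult using s by (intro mult_mono) auto
    then have "norm (1 / \<phi>k (s * t)) \<le> K"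
      by (intro K(2)) auto
    then have "norm (\<phi>w t) * norm (1 / \<phi>k (s * t)) \<le> 1 * K"
      using \<phi>w_le K(1) by (intro mult_mono) auto
    then show ?thesis
      by (simp add: Q_def norm_divide)
  qed (use K(1) Q_supp in auto)
  with K(1) show thesis by (rule that)
qed

lemma Q_integrable: "integrable lborel (Q s)"
proof -
  obtain K where K: "0 < K" "\<And>t. norm (Q s t) \<le> K"
    using Q_bound[of "\<bar>s\<bar>"] by (metis order_refl)
  show ?thesis
  proof (rule Bochner_Integration.integrable_bound)
    show "integrable lborel (\<lambda>t::real. K * indicator {-1..1} t)"
      by simp
  qed (use K Q_supp[of _ s] in \<open>auto simp: indicator_def abs_le_iff not_le\<close>)
qed

lemma W_measurable [measurable]: "W s \<in> borel_measurable borel"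
  unfolding W_eq[abs_def] by measurable

text \<open>A transform is bounded by the norm integral of \<open>Q s\<close>, at most
  \<open>2 * K\<close> on \<open>[-1, 1]\<close>. Uniformity in \<open>s\<close> later gives one
  constant for all rows of the triangular array.\<close>

lemma W_bound:
  obtains K where "0 < K" "\<And>s u. \<bar>s\<bar> \<le> R \<Longrightarrow> norm (W s u) \<le> K"
proof -
  obtain K where K: "0 < K" "\<And>s t. \<bar>s\<bar> \<le> R \<Longrightarrow> norm (Q s t) \<le> K"
    using Q_bound by blast
  have "norm (W s u) \<le> 1 / (2 * pi) * (2 * K)" if s: "\<bar>s\<bar> \<le> R" for s u
  proof -
    have "norm (fourier (Q s) u) \<le> (LBINT t. norm (Q s t))"
      by (rule norm_fourier_le[OF Q_integrable])
    also have "\<dots> \<le> (LBINT t. K * indicator {-1..1} (t::real))"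
    proof (rule integral_mono)
      show "integrable lborel (\<lambda>t::real. K * indicator {-1..1} t)"
        by simp
    qed (use K(2)[OF s] Q_supp[of _ s] Q_integrable[of s] in \<open>auto simp: indicator_def abs_le_iff not_le\<close>)
    finally have "norm (fourier (Q s) u) \<le> 2 * K" by simp
    then show ?thesis
      unfolding W_eq norm_mult norm_of_real by (intro mult_mono) auto
  qed
  then show thesis
    using K(1) by (intro that[of "1 / (2 * pi) * (2 * K)"]) auto
qed

text \<open>Reflecting \<open>t\<close> maps the integrand to its conjugate, so the integral equals
  its own conjugate. Hence taking \<open>Re\<close> loses nothing, and the squared modulus is the
  squared real part.\<close>

lemma Im_W: "Im (W s u) = 0"
proof -
  have "cnj (fourier (Q s) u) = (CLBINT t. cnj (iexp (- (t * u)) * Q s t))"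
    unfolding fourier_def by (rule Bochner_Integration.integral_cnj[symmetric])
  also have "\<dots> = \<bar>-1\<bar> *\<^sub>R (CLBINT t. cnj (iexp (- ((0 + (-1) * t) * u)) * Q s (0 + (-1) * t)))"
    by (rule lborel_integral_real_affine) simp
  also have "\<dots> = fourier (Q s) u"
    by (simp add: fourier_def Q_def \<phi>w_cnj \<phi>k_cnj exp_cnj)
  finally have "cnj (fourier (Q s) u) = fourier (Q s) u" .
  then have "Im (fourier (Q s) u) = 0"
    by (metis Reals_cnj_iff complex_is_Real_iff)
  then show ?thesis
    by (simp add: W_eq)
qed

lemma W_square_integrable: "integrable lborel (\<lambda>u. (Re (W s u))\<^sup>2)"
proof -
  obtain K where K: "\<And>t. norm (Q s t) \<le> K"
    using Q_bound[of "\<bar>s\<bar>"] by (metis order_refl)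
  have "integrable lborel (\<lambda>u. (1 / (2 * pi))\<^sup>2 * (norm (fourier (Q s) u))\<^sup>2)"
    using fourier_square_integrable(1)[OF Q_measurable K Q_supp] by simp
  moreover have "(Re (W s u))\<^sup>2 = (1 / (2 * pi))\<^sup>2 * (norm (fourier (Q s) u))\<^sup>2" for u
    using Im_W[of s u] by (simp add: W_eq norm_mult power_mult_distrib cmod_def power_divide)
  ultimately show ?thesis by simp
qed

text \<open>By linearity the difference is the transform of \<open>Q (s n) - Q r\<close>, which is
  supported in \<open>[-1, 1]\<close>; a uniform bound on this function controls the square
  integral. The uniform bound comes from uniform continuity of \<open>1 / \<phi>k\<close> on a
  compact interval.\<close>

lemma W_L2_convergence:
  assumes s: "s \<longlonglongrightarrow> r"
  shows "(\<lambda>n. LBINT u. (Re (W (s n) u) - Re (W r u))\<^sup>2) \<longlonglongrightarrow> 0"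
proof -
  \<comment> \<open>A single \<open>R\<close> puts every argument \<open>s n * t\<close> and
    \<open>r * t\<close> with \<open>\<bar>t\<bar> \<le> 1\<close> into the same compact
    interval.\<close>
  obtain R where R: "\<And>n. \<bar>s n\<bar> \<le> R" "\<bar>r\<bar> \<le> R"
  proof -
    obtain B where "\<And>n. norm (s n) \<le> B"
      using convergent_imp_Bseq[of s] s unfolding convergent_def Bseq_def by auto
    then show thesis by (intro that[of "max B \<bar>r\<bar>"]) (auto intro: max.coboundedI1)
  qed
  have bound: "(LBINT u. (Re (W (s n) u) - Re (W r u))\<^sup>2) \<le> \<delta>\<^sup>2"
    if \<delta>: "\<And>t. norm (Q (s n) t - Q r t) \<le> \<delta>" for n \<delta>
  proof -
    have *: "(Re (W (s n) u) - Re (W r u))\<^sup>2 = (1 / (2 * pi))\<^sup>2 * (norm (fourier (\<lambda>t. Q (s n) t - Q r t) u))\<^sup>2" for u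
    proof -
      have "fourier (\<lambda>t. Q (s n) t - Q r t) u = fourier (Q (s n)) u - fourier (Q r) u"
        unfolding fourier_def right_diff_distrib
        by (rule Bochner_Integration.integral_diff) (rule integrable_iexp_mult(2)[OF Q_integrable])+
      then have "complex_of_real (1 / (2 * pi)) * fourier (\<lambda>t. Q (s n) t - Q r t) u = W (s n) u - W r u"
        by (simp add: W_eq right_diff_distrib)
      also have "\<dots> = complex_of_real (Re (W (s n) u) - Re (W r u))"
        by (simp add: complex_eq_iff Im_W)
      finally have "norm (complex_of_real (1 / (2 * pi)) * fourier (\<lambda>t. Q (s n) t - Q r t) u) = \<bar>Re (W (s n) u) - Re (W r u)\<bar>"
        by (simp only: norm_of_real)
      then have "\<bar>Re (W (s n) u) - Re (W r u)\<bar>\<^sup>2 = (1 / (2 * pi) * norm (fourier (\<lambda>t. Q (s n) t - Q r t) u))\<^sup>2"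
        by (simp only: norm_mult norm_of_real) simp
      then show ?thesis by (simp only: power2_abs power_mult_distrib)
    qed
    have "(LBINT u. (Re (W (s n) u) - Re (W r u))\<^sup>2) \<le> (1 / (2 * pi))\<^sup>2 * (4 * pi * \<delta>\<^sup>2)"
      unfolding * integral_mult_right_zero
      by (intro mult_left_mono fourier_square_integrable(2) \<delta>) (auto simp: Q_supp)
    also have "\<dots> = \<delta>\<^sup>2 / pi"
      by (simp add: power2_eq_square field_simps)
    also have "\<dots> \<le> \<delta>\<^sup>2"
      using pi_gt3 by (simp add: divide_le_eq mult_le_cancel_left1)
    finally show ?thesis .
  qed
  have unif: "uniformly_continuous_on {-R..R} (\<lambda>t. 1 / \<phi>k t)"
    by (intro compact_uniformly_continuous continuous_intros continuous_on_subset[OF \<phi>k_cont])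
       (auto simp: \<phi>k_nonzero)
  have Q_close: "\<forall>\<^sub>F n in sequentially. \<forall>t. norm (Q (s n) t - Q r t) \<le> \<delta>" if \<delta>: "0 < \<delta>" for \<delta>
  proof -
    obtain d where d: "0 < d" and dd: "\<And>a b. a \<in> {-R..R} \<Longrightarrow> b \<in> {-R..R} \<Longrightarrow> dist a b < d \<Longrightarrow> dist (1 / \<phi>k a) (1 / \<phi>k b) < \<delta>"
      using unif \<delta> unfolding uniformly_continuous_on_def by metis
    have "\<forall>\<^sub>F n in sequentially. dist (s n) r < d"
      using s d by (rule tendstoD)
    then show ?thesis
    proof eventually_elim
      case (elim n)
      show ?case
      proof
        fix t
        show "norm (Q (s n) t - Q r t) \<le> \<delta>"
        proof (cases "\<bar>t\<bar> \<le> 1")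
          case True
          have in_range: "s' * t \<in> {-R..R}" if "\<bar>s'\<bar> \<le> R" for s'
          proof -
            have "\<bar>s' * t\<bar> \<le> R * 1"
              unfolding abs_mult using that True by (intro mult_mono) auto
            then show ?thesis by auto
          qed
          \<comment> \<open>On the support of \<open>\<phi>w\<close> the two arguments are no
            further apart than \<open>s n\<close> and \<open>r\<close>, whatever \<open>t\<close>
            is; this makes the estimate uniform in \<open>t\<close>.\<close>
          have "dist (s n * t) (r * t) = dist (s n) r * \<bar>t\<bar>"
            by (simp add: dist_real_def abs_mult flip: left_diff_distrib)
          also have "\<dots> \<le> dist (s n) r * 1"
            using True by (intro mult_left_mono) auto
          finally have "dist (1 / \<phi>k (s n * t)) (1 / \<phi>k (r * t)) < \<delta>"
            using elim by (intro dd in_range R) auto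
          then have "norm (\<phi>w t) * norm (1 / \<phi>k (s n * t) - 1 / \<phi>k (r * t)) \<le> 1 * \<delta>"
            using \<phi>w_le \<delta> by (intro mult_mono) (auto simp: dist_norm)
          then show ?thesis
            by (simp add: Q_def norm_mult[symmetric] right_diff_distrib)
        qed (use \<delta> Q_supp in auto)
      qed
    qed
  qed
  show ?thesis
  proof (rule tendstoI)
    fix \<epsilon> :: real assume \<epsilon>: "0 < \<epsilon>"
    define \<delta> where "\<delta> = sqrt (\<epsilon> / 2)"
    have \<delta>: "0 < \<delta>" "\<delta>\<^sup>2 < \<epsilon>"
      using \<epsilon> by (auto simp: \<delta>_def)
    show "\<forall>\<^sub>F n in sequentially. dist (LBINT u. (Re (W (s n) u) - Re (W r u))\<^sup>2) 0 < \<epsilon>"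
      using Q_close[OF \<delta>(1)]
    proof eventually_elim
      case (elim n)
      then have "(LBINT u. (Re (W (s n) u) - Re (W r u))\<^sup>2) \<le> \<delta>\<^sup>2"
        by (intro bound) auto
      then show ?case
        using \<delta>(2) by (simp add: dist_real_def)
    qed
  qed
qed

end

section \<open>A central limit theorem for bounded triangular arrays\<close>

lemma real_distribution_normal_law:
  assumes "0 \<le> v"
  shows "real_distribution (normal_law m v)"
proof (cases "v = 0")
  case True
  then show ?thesis
    unfolding normal_law_def real_distribution_def real_distribution_axioms_def
    by (auto intro!: prob_space_return)
next
  case False
  then have "0 < sqrt v" using assms by simp
  then show ?thesis
    using False unfolding normal_law_def real_distribution_def real_distribution_axioms_def
    by (auto intro: prob_space_normal_density)
qed

text \<open>The point mass at \<open>v = 0\<close> obeys the same formula, so the limit theorem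
  needs no case distinction even if the limiting variance vanishes, as it does where
  \<open>f x = 0\<close>. For positive \<open>v\<close>, rescaling by \<open>sqrt v\<close> reduces
  to the standard normal law.\<close>

lemma char_normal_law:
  assumes v: "0 \<le> v"
  shows "char (normal_law 0 v) t = complex_of_real (exp (- (t\<^sup>2 * v / 2)))"
proof (cases "v = 0")
  case True
  then show ?thesis
    unfolding normal_law_def char_def by (simp add: integral_return)
next
  case False
  then have s: "0 < sqrt v" using v by simp
  have "char (normal_law 0 v) t = (CLBINT y. normal_density 0 (sqrt v) y *\<^sub>R iexp (t * y))"
    unfolding normal_law_def char_def using False by (simp, subst integral_density) auto
  also have "\<dots> = sqrt v *\<^sub>R (CLBINT y. normal_density 0 (sqrt v) (0 + sqrt v * y) *\<^sub>R iexp (t * (0 + sqrt v * y)))"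
    using s by (subst lborel_integral_real_affine[where c="sqrt v" and t=0]) auto
  also have "\<dots> = (CLBINT y. std_normal_density y *\<^sub>R iexp ((t * sqrt v) * y))"
    unfolding integral_scaleR_right[symmetric]
  proof (intro Bochner_Integration.integral_cong refl)
    fix y
    have "sqrt v * normal_density 0 (sqrt v) (0 + sqrt v * y) = std_normal_density y"
      using s by (simp add: normal_density_def power_mult_distrib real_sqrt_mult field_simps)
    then show "sqrt v *\<^sub>R normal_density 0 (sqrt v) (0 + sqrt v * y) *\<^sub>R iexp (t * (0 + sqrt v * y))
       = std_normal_density y *\<^sub>R iexp ((t * sqrt v) * y)"
      by (simp add: ac_simps)
  qed
  also have "\<dots> = char std_normal_distribution (t * sqrt v)"
    unfolding char_def by (subst integral_density) auto
  finally show ?thesis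
    using v by (simp add: char_std_normal_distribution power_mult_distrib)
qed

text \<open>By independence the sum has characteristic function \<open>char (\<mu> n) t ^ n\<close>.
  The bound \<open>b n\<close> makes the third absolute moment small relative to the second, so the
  quadratic expansion of \<open>char (\<mu> n) t\<close> is accurate to order less than
  \<open>1 / n\<close>, and the power can be compared with an exponential sequence. The law
  \<open>\<mu> n\<close> varies with \<open>n\<close>, which is why a triangular array is
  treated.\<close>

lemma bounded_triangular_array_clt:
  fixes M :: "nat \<Rightarrow> 'a measure" and \<xi> :: "nat \<Rightarrow> nat \<Rightarrow> 'a \<Rightarrow> real" and \<mu> :: "nat \<Rightarrow> real measure"
  assumes prob: "\<And>n. prob_space (M n)"
    and indep: "\<And>n. prob_space.indep_vars (M n) (\<lambda>_. borel) (\<xi> n) {1..n}"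
    and law: "\<And>n j. j \<in> {1..n} \<Longrightarrow> distr (M n) borel (\<xi> n j) = \<mu> n"
    and \<mu>: "\<And>n. real_distribution (\<mu> n)"
    and bounded: "\<And>n. AE y in \<mu> n. \<bar>y\<bar> \<le> b n"
    and mean: "\<And>n. (\<integral>y. y \<partial>\<mu> n) = 0"
    and variance: "(\<lambda>n. real n * (\<integral>y. y\<^sup>2 \<partial>\<mu> n)) \<longlonglongrightarrow> v"
    and b: "b \<longlonglongrightarrow> 0"
  shows "weak_conv_m (\<lambda>n. distr (M n) borel (\<lambda>\<omega>. \<Sum>j\<in>{1..n}. \<xi> n j \<omega>)) (normal_law 0 v)"
proof (rule levy_continuity)
  define c where "c n = (\<integral>y. y\<^sup>2 \<partial>\<mu> n)" for n
  have c0: "0 \<le> c n" for n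
    unfolding c_def by simp
  have v: "0 \<le> v"
    using variance by (rule LIMSEQ_le_const) (auto intro!: mult_nonneg_nonneg)
  show "real_distribution (normal_law 0 v)"
    using v by (rule real_distribution_normal_law)
  have \<xi>_meas: "\<xi> n j \<in> borel_measurable (M n)" if "j \<in> {1..n}" for n j
  proof -
    interpret prob_space "M n" by (rule prob)
    show ?thesis
      using indep[of n] that unfolding indep_vars_def by auto
  qed
  show "real_distribution (distr (M n) borel (\<lambda>\<omega>. \<Sum>j\<in>{1..n}. \<xi> n j \<omega>))" for n
  proof -
    interpret prob_space "M n" by (rule prob)
    show ?thesis
      using \<xi>_meas by (intro real_distribution_distr borel_measurable_sum) auto
  qed
  fix t :: real
  have char_sum: "char (distr (M n) borel (\<lambda>\<omega>. \<Sum>j\<in>{1..n}. \<xi> n j \<omega>)) t = char (\<mu> n) t ^ n" for n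
  proof -
    interpret prob_space "M n" by (rule prob)
    have "char (distr (M n) borel (\<lambda>\<omega>. \<Sum>j\<in>{1..n}. \<xi> n j \<omega>)) t = (\<Prod>j\<in>{1..n}. char (\<mu> n) t)"
      unfolding char_distr_sum[OF indep] by (intro prod.cong) (auto simp: law)
    then show ?thesis by simp
  qed
  \<comment> \<open>Only the cubic branch of the minimum in \<open>char_approx3\<close> is used:
    almost surely \<open>\<bar>y\<bar> ^ 3\<close> is at most
    \<open>\<bar>b n\<bar> * y\<^sup>2\<close>. The absolute value avoids a sign assumption on
    \<open>b\<close>.\<close>
  have approx: "norm (char (\<mu> n) t - (1 - t\<^sup>2 * c n / 2)) \<le> \<bar>t\<bar> ^ 3 / 6 * (\<bar>b n\<bar> * c n)" for n
  proof -
    interpret real_distribution "\<mu> n" by (rule \<mu>)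
    have int: "integrable (\<mu> n) (\<lambda>y. y ^ m)" for m
    proof (rule integrable_const_bound[where B="b n ^ m"])
      show "AE y in \<mu> n. norm (y ^ m) \<le> b n ^ m"
        using bounded[of n] by eventually_elim (auto simp: power_abs intro: power_mono)
    qed auto
    have int1: "integrable (\<mu> n) (\<lambda>y. y)"
      using int[of 1] by simp
    have "norm (char (\<mu> n) t - (1 - t\<^sup>2 * c n / 2))
        \<le> (t\<^sup>2 / 6) * (\<integral>y. min (6 * y\<^sup>2) (\<bar>t\<bar> * \<bar>y\<bar> ^ 3) \<partial>\<mu> n)"
      using int1 int[of 2] mean[of n] by (intro char_approx3) (auto simp: c_def)
    also have "\<dots> \<le> (t\<^sup>2 / 6) * (\<integral>y. \<bar>t\<bar> * \<bar>b n\<bar> * y\<^sup>2 \<partial>\<mu> n)"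
    proof (intro mult_left_mono integral_mono_AE)
      show "integrable (\<mu> n) (\<lambda>y. \<bar>t\<bar> * \<bar>b n\<bar> * y\<^sup>2)"
        using int[of 2] by simp
      show "integrable (\<mu> n) (\<lambda>y. min (6 * y\<^sup>2) (\<bar>t\<bar> * \<bar>y\<bar> ^ 3))"
        by (rule Bochner_Integration.integrable_bound[OF integrable_mult_right[OF int[of 2], of 6]]) auto
      show "AE y in \<mu> n. min (6 * y\<^sup>2) (\<bar>t\<bar> * \<bar>y\<bar> ^ 3) \<le> \<bar>t\<bar> * \<bar>b n\<bar> * y\<^sup>2"
        using bounded[of n]
      proof eventually_elim
        case (elim y)
        have "\<bar>y\<bar> ^ 3 = \<bar>y\<bar> * y\<^sup>2"
          by (simp add: power3_eq_cube power2_eq_square)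
        also have "\<dots> \<le> \<bar>b n\<bar> * y\<^sup>2"
          using elim by (intro mult_right_mono) auto
        finally show ?case
          by (intro min.coboundedI2) (simp add: mult.assoc mult_left_mono)
      qed
    qed auto
    also have "\<dots> = \<bar>t\<bar> ^ 3 / 6 * (\<bar>b n\<bar> * c n)"
      by (simp add: c_def power3_eq_cube power2_eq_square)
    finally show ?thesis .
  qed
  have c_lim: "c \<longlonglongrightarrow> 0"
  proof -
    have "(\<lambda>n. (real n * c n) * (1 / real n)) \<longlonglongrightarrow> v * 0"
      using variance unfolding c_def[symmetric] by (intro tendsto_mult lim_1_over_n)
    moreover have "\<forall>\<^sub>F n in sequentially. (real n * c n) * (1 / real n) = c n"
      using eventually_gt_at_top[of 0] by eventually_elim auto
    ultimately show ?thesis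
      by (simp add: tendsto_cong)
  qed
  \<comment> \<open>\<open>?p\<close> is the quadratic approximation of the characteristic function;
    \<open>?q\<close> is the base whose \<open>n\<close>-th powers tend to the characteristic
    function of the limit.\<close>
  let ?p = "\<lambda>n. 1 - t\<^sup>2 * c n / 2" and ?q = "\<lambda>n. 1 + (- (t\<^sup>2 * v / 2)) / real n"
  have p_le: "\<forall>\<^sub>F n in sequentially. \<bar>?p n\<bar> \<le> 1"
  proof -
    have "(\<lambda>n. t\<^sup>2 * c n / 2) \<longlonglongrightarrow> t\<^sup>2 * 0 / 2"
      by (intro tendsto_intros c_lim) auto
    then have "\<forall>\<^sub>F n in sequentially. t\<^sup>2 * c n / 2 < 1"
      by (rule order_tendstoD) simp
    then show ?thesis
    proof eventually_elim
      case (elim n)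
      moreover have "0 \<le> t\<^sup>2 * c n / 2"
        using c0[of n] by simp
      ultimately show ?case by linarith
    qed
  qed
  \<comment> \<open>\<open>norm_power_diff\<close> compares powers of numbers in the closed unit
    disc; characteristic functions always qualify, \<open>?q n\<close> does for large
    \<open>n\<close>.\<close>
  have q_le: "\<forall>\<^sub>F n in sequentially. \<bar>?q n\<bar> \<le> 1"
  proof -
    have "(\<lambda>n. (t\<^sup>2 * v / 2) * (1 / real n)) \<longlonglongrightarrow> (t\<^sup>2 * v / 2) * 0"
      by (intro tendsto_intros lim_1_over_n)
    then have "\<forall>\<^sub>F n in sequentially. (t\<^sup>2 * v / 2) * (1 / real n) < 1"
      by (rule order_tendstoD) simp
    then show ?thesis
    proof eventually_elim
      case (elim n)
      moreover have "0 \<le> (t\<^sup>2 * v / 2) * (1 / real n)"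
        using v by simp
      ultimately show ?case by (simp add: abs_le_iff)
    qed
  qed
  \<comment> \<open>Passing from powers to bases costs a factor \<open>n\<close>. In the first term
    it joins \<open>c n\<close>, and \<open>real n * c n\<close> converges; in the second it cancels
    the \<open>1 / n\<close> of \<open>?p n - ?q n\<close>.\<close>
  have main: "\<forall>\<^sub>F n in sequentially. norm (char (\<mu> n) t ^ n - complex_of_real (?q n) ^ n)
      \<le> \<bar>t\<bar> ^ 3 / 6 * (\<bar>b n\<bar> * (real n * c n)) + t\<^sup>2 / 2 * \<bar>real n * c n - v\<bar>"
    using p_le q_le eventually_gt_at_top[of 0]
  proof eventually_elim
    case (elim n)
    interpret real_distribution "\<mu> n" by (rule \<mu>)
    have "norm (char (\<mu> n) t ^ n - complex_of_real (?q n) ^ n)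
        \<le> real n * norm (char (\<mu> n) t - complex_of_real (?q n))"
      using elim by (intro norm_power_diff cmod_char_le_1) (auto simp del: of_real_diff of_real_add)
    also have "norm (char (\<mu> n) t - complex_of_real (?q n))
        \<le> norm (char (\<mu> n) t - complex_of_real (?p n)) + norm (complex_of_real (?p n) - complex_of_real (?q n))"
      by norm
    also have "norm (complex_of_real (?p n) - complex_of_real (?q n)) = \<bar>?p n - ?q n\<bar>"
      by (simp flip: of_real_diff)
    also have "\<bar>?p n - ?q n\<bar> = t\<^sup>2 / 2 * \<bar>real n * c n - v\<bar> / real n"
    proof -
      have "?p n - ?q n = - (t\<^sup>2 / 2 * (real n * c n - v) / real n)"
        using elim by (simp add: field_simps)
      then show ?thesis
        by (simp add: abs_mult)
    qed
    also have "norm (char (\<mu> n) t - complex_of_real (?p n)) \<le> \<bar>t\<bar> ^ 3 / 6 * (\<bar>b n\<bar> * c n)"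
      using approx[of n] by simp
    finally show ?case
      using elim by (simp add: algebra_simps)
  qed
  have "(\<lambda>n. \<bar>t\<bar> ^ 3 / 6 * (\<bar>b n\<bar> * (real n * c n)) + t\<^sup>2 / 2 * \<bar>real n * c n - v\<bar>)
      \<longlonglongrightarrow> \<bar>t\<bar> ^ 3 / 6 * (\<bar>0\<bar> * v) + t\<^sup>2 / 2 * \<bar>v - v\<bar>"
    using variance unfolding c_def[symmetric] by (intro tendsto_intros b)
  then have lim0: "(\<lambda>n. \<bar>t\<bar> ^ 3 / 6 * (\<bar>b n\<bar> * (real n * c n)) + t\<^sup>2 / 2 * \<bar>real n * c n - v\<bar>) \<longlonglongrightarrow> 0"
    by simp
  have "(\<lambda>n. complex_of_real ((?q n) ^ n)) \<longlonglongrightarrow> complex_of_real (exp (- (t\<^sup>2 * v / 2)))"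
    by (rule isCont_tendsto_compose [OF _ tendsto_exp_limit_sequentially]) auto
  then have q_lim: "(\<lambda>n. complex_of_real (?q n) ^ n) \<longlonglongrightarrow> complex_of_real (exp (- (t\<^sup>2 * v / 2)))"
    by (simp only: of_real_power)
  show "(\<lambda>n. char (distr (M n) borel (\<lambda>\<omega>. \<Sum>j\<in>{1..n}. \<xi> n j \<omega>)) t) \<longlonglongrightarrow> char (normal_law 0 v) t"
    unfolding char_sum char_normal_law[OF v]
    by (rule Lim_transform[OF q_lim]) (rule Lim_null_comparison[OF main lim0])
qed

section \<open>Observations with additive noise\<close>

abbreviation law_of_density :: "(real \<Rightarrow> real) \<Rightarrow> real measure" where
  "law_of_density g \<equiv> density lborel (\<lambda>y. ennreal (g y))"

lemma prob_space_law_of_density: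
  assumes "prob_density g"
  shows "prob_space (law_of_density g)"
proof
  have "(\<integral>\<^sup>+ y. ennreal (g y) \<partial>lborel) = ennreal (LBINT y. g y)"
    using assms by (intro nn_integral_eq_integral) (auto simp: prob_density_def)
  then show "emeasure (law_of_density g) (space (law_of_density g)) = 1"
    using assms by (subst emeasure_density) (auto simp: prob_density_def)
qed

lemma real_distribution_law_of_density:
  "prob_density g \<Longrightarrow> real_distribution (law_of_density g)"
  using prob_space_law_of_density unfolding real_distribution_def real_distribution_axioms_def by auto

lemma char_of_density_cnj: "char_of_density g (- t) = cnj (char_of_density g t)"
  unfolding char_of_density_def char_def
  by (subst Bochner_Integration.integral_cnj[symmetric]) (simp add: exp_cnj)

lemma char_of_density_continuous:
  assumes "prob_density g"
  shows "continuous_on UNIV (char_of_density g)"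
  using real_distribution.isCont_char[OF real_distribution_law_of_density[OF assms]]
  unfolding char_of_density_def by (simp add: continuous_on_eq_continuous_at)

definition noisy_law :: "(real \<Rightarrow> real) \<Rightarrow> (real \<Rightarrow> real) \<Rightarrow> real \<Rightarrow> real measure" where
  "noisy_law f k \<sigma> = distr (law_of_density f \<Otimes>\<^sub>M law_of_density k) borel (\<lambda>p. fst p + \<sigma> * snd p)"

lemma sets_noisy_law [simp, measurable_cong]: "sets (noisy_law f k \<sigma>) = sets borel"
  by (simp add: noisy_law_def)

lemma space_noisy_law [simp]: "space (noisy_law f k \<sigma>) = UNIV"
  by (simp add: noisy_law_def)

lemma (in prob_space) distr_add_noise:
  assumes Y: "distributed M lborel Y (\<lambda>y. ennreal (f y))"
    and Z: "distributed M lborel Z (\<lambda>z. ennreal (k z))"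
    and indep: "indep_var borel Y borel Z"
  shows "distr M borel (\<lambda>\<omega>. Y \<omega> + \<sigma> * Z \<omega>) = noisy_law f k \<sigma>"
proof -
  have [measurable]: "Y \<in> borel_measurable M" "Z \<in> borel_measurable M"
    using Y Z by (auto simp: distributed_def)
  have laws: "distr M borel Y = law_of_density f" "distr M borel Z = law_of_density k"
    using Y Z by (auto simp: distributed_def cong: distr_cong)
  have "distr M borel (\<lambda>\<omega>. Y \<omega> + \<sigma> * Z \<omega>)
      = distr (distr M (borel \<Otimes>\<^sub>M borel) (\<lambda>\<omega>. (Y \<omega>, Z \<omega>))) borel (\<lambda>p. fst p + \<sigma> * snd p)"
    by (subst distr_distr) (auto simp: comp_def)
  also have "distr M (borel \<Otimes>\<^sub>M borel) (\<lambda>\<omega>. (Y \<omega>, Z \<omega>)) = law_of_density f \<Otimes>\<^sub>M law_of_density k"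
    using indep unfolding indep_var_distribution_eq laws by simp
  finally show ?thesis
    unfolding noisy_law_def .
qed

text \<open>\<open>B\<close> supplies the majorants for dominated convergence and Fubini. It is
  abstract here; the theorem takes the constant of \<open>density_bounded_by_char\<close>.\<close>

locale noisy_density =
  fixes f k :: "real \<Rightarrow> real" and B :: real
  assumes f: "prob_density f" and k: "prob_density k"
    and f_cont: "continuous_on UNIV f" and f_le: "\<And>y. f y \<le> B"
begin

sublocale K: prob_space "law_of_density k"
  using k by (rule prob_space_law_of_density)

sublocale F: prob_space "law_of_density f"
  using f by (rule prob_space_law_of_density)

sublocale FK: pair_prob_space "law_of_density f" "law_of_density k" ..

sublocale LK: pair_sigma_finite lborel "law_of_density k" ..

lemma f_nonneg: "0 \<le> f y"
  using f by (simp add: prob_density_def)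

lemma B_nonneg: "0 \<le> B"
  using f_nonneg f_le order_trans by blast

lemma f_measurable [measurable]: "f \<in> borel_measurable borel"
  using f by (auto simp: prob_density_def)

lemma noisy_law_real_distribution: "real_distribution (noisy_law f k \<sigma>)"
  unfolding noisy_law_def
  by (rule FK.real_distribution_distr) measurable

text \<open>The noise integral is placed outermost so that, for each fixed noise value
  \<open>z\<close>, the inner Lebesgue integral admits a substitution.\<close>

lemma integral_noisy_law:
  fixes F :: "real \<Rightarrow> 'b :: {banach, second_countable_topology}"
  assumes [measurable]: "F \<in> borel_measurable borel" and bound: "\<And>y. norm (F y) \<le> C"
  shows "(\<integral>y. F y \<partial>noisy_law f k \<sigma>) = (\<integral>z. (LBINT y. f y *\<^sub>R F (y + \<sigma> * z)) \<partial>law_of_density k)"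
proof -
  have int: "integrable (law_of_density f \<Otimes>\<^sub>M law_of_density k) (\<lambda>(y, z). F (y + \<sigma> * z))"
    by (rule FK.P.integrable_const_bound[where B=C]) (auto simp: bound split: prod.split)
  have "(\<integral>y. F y \<partial>noisy_law f k \<sigma>) = (\<integral>(y, z). F (y + \<sigma> * z) \<partial>(law_of_density f \<Otimes>\<^sub>M law_of_density k))"
    unfolding noisy_law_def by (subst integral_distr) (simp_all add: case_prod_unfold)
  also have "\<dots> = (\<integral>z. \<integral>y. F (y + \<sigma> * z) \<partial>law_of_density f \<partial>law_of_density k)"
    using FK.integral_snd[OF int] by simp
  also have "\<dots> = (\<integral>z. (LBINT y. f y *\<^sub>R F (y + \<sigma> * z)) \<partial>law_of_density k)"
    by (subst integral_density) (auto simp: f_nonneg)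
  finally show ?thesis .
qed

text \<open>The noise factor is exactly the denominator in the deconvolution integral;
  \<open>mean_bound\<close> rests on this cancellation.\<close>

lemma char_noisy_law:
  "char (noisy_law f k \<sigma>) t = char_of_density f t * char_of_density k (\<sigma> * t)"
proof -
  have *: "(CLBINT y. f y *\<^sub>R iexp (t * (y + \<sigma> * z))) = iexp ((\<sigma> * t) * z) * char_of_density f t" for z
  proof -
    have "(CLBINT y. f y *\<^sub>R iexp (t * (y + \<sigma> * z))) = (CLBINT y. iexp ((\<sigma> * t) * z) * (f y *\<^sub>R iexp (t * y)))"
      by (intro Bochner_Integration.integral_cong refl) (simp add: exp_add[symmetric] algebra_simps)
    also have "\<dots> = iexp ((\<sigma> * t) * z) * char_of_density f t"
      unfolding integral_mult_right_zero char_of_density_def char_def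
      by (subst integral_density) (auto simp: f_nonneg)
    finally show ?thesis .
  qed
  have "char (noisy_law f k \<sigma>) t = (\<integral>z. (CLBINT y. f y *\<^sub>R iexp (t * (y + \<sigma> * z))) \<partial>law_of_density k)"
    unfolding char_def by (rule integral_noisy_law[where C=1]) auto
  also have "\<dots> = (\<integral>z. iexp ((\<sigma> * t) * z) * char_of_density f t \<partial>law_of_density k)"
    unfolding * ..
  also have "\<dots> = char_of_density f t * char_of_density k (\<sigma> * t)"
    unfolding integral_mult_left_zero by (simp add: char_of_density_def[of k] char_def)
  finally show ?thesis .
qed

text \<open>The density of \<open>noisy_law f k \<sigma>\<close> at the point
  \<open>x - h * u\<close>, as a convolution.\<close>

definition smoothed :: "real \<Rightarrow> real \<Rightarrow> real \<Rightarrow> real \<Rightarrow> real" where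
  "smoothed x h \<sigma> u = (\<integral>z. f (x - h * u - \<sigma> * z) \<partial>law_of_density k)"

lemma smoothed_measurable [measurable]: "smoothed x h \<sigma> \<in> borel_measurable borel"
proof -
  have "smoothed x h \<sigma> \<in> borel_measurable lborel"
    unfolding smoothed_def[abs_def]
    by (rule K.borel_measurable_lebesgue_integral) measurable
  then show ?thesis by simp
qed

lemma f_integrable_K: "integrable (law_of_density k) (\<lambda>z. f (a + b * z))"
  by (rule K.integrable_const_bound[where B=B]) (auto simp: f_nonneg f_le)

lemma smoothed_nonneg: "0 \<le> smoothed x h \<sigma> u"
  unfolding smoothed_def by (simp add: f_nonneg)

lemma smoothed_le: "smoothed x h \<sigma> u \<le> B"
  unfolding smoothed_def
  using f_integrable_K[of "x - h * u" "- \<sigma>"]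
  by (intro K.integral_le_const) (auto simp: f_le)

lemma smoothed_tendsto:
  assumes "h \<longlonglongrightarrow> 0" "\<sigma> \<longlonglongrightarrow> 0"
  shows "(\<lambda>n. smoothed x (h n) (\<sigma> n) u) \<longlonglongrightarrow> f x"
proof -
  have "(\<lambda>n. \<integral>z. f (x - h n * u - \<sigma> n * z) \<partial>law_of_density k) \<longlonglongrightarrow> (\<integral>z. f x \<partial>law_of_density k)"
  proof (rule integral_dominated_convergence[where w="\<lambda>_. B"])
    show "AE z in law_of_density k. (\<lambda>n. f (x - h n * u - \<sigma> n * z)) \<longlonglongrightarrow> f x"
    proof (intro AE_I2)
      fix z
      have "(\<lambda>n. x - h n * u - \<sigma> n * z) \<longlonglongrightarrow> x - 0 * u - 0 * z"
        by (intro tendsto_intros assms)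
      then have "(\<lambda>n. x - h n * u - \<sigma> n * z) \<longlonglongrightarrow> x" by simp
      then show "(\<lambda>n. f (x - h n * u - \<sigma> n * z)) \<longlonglongrightarrow> f x"
        using f_cont by (auto simp: continuous_on_eq_continuous_at intro: isCont_tendsto_compose)
    qed
  qed (auto simp: f_nonneg f_le)
  then show ?thesis
    using K.prob_space by (simp add: smoothed_def)
qed

text \<open>For fixed \<open>z\<close>, the substitution \<open>y = x - h * u - \<sigma> * z\<close>
  has Jacobian \<open>h\<close> and turns the argument of \<open>\<psi>\<close> into
  \<open>u\<close>; Fubini then gathers the values of \<open>f\<close> into \<open>smoothed\<close>.
  It is applied to the square of the kernel.\<close>

lemma integral_noisy_law_rescaled:
  assumes \<psi>: "integrable lborel \<psi>" and bound: "\<And>u. \<bar>\<psi> u\<bar> \<le> C" and h: "0 < h"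
  shows "(\<integral>y. \<psi> ((x - y) / h) \<partial>noisy_law f k \<sigma>) = h * (LBINT u. \<psi> u * smoothed x h \<sigma> u)"
proof -
  have [measurable]: "\<psi> \<in> borel_measurable borel"
    using \<psi> by simp
  let ?F = "\<lambda>u z. \<psi> u * f (x - h * u - \<sigma> * z)"
  have int: "integrable (lborel \<Otimes>\<^sub>M law_of_density k) (\<lambda>(u, z). ?F u z)"
  proof (rule LK.Fubini_integrable)
    have "integrable lborel (\<lambda>u. \<bar>\<psi> u\<bar> * smoothed x h \<sigma> u)"
    proof (rule Bochner_Integration.integrable_bound)
      show "integrable lborel (\<lambda>u. \<bar>\<psi> u\<bar> * B)"
        using \<psi> by simp
    qed (auto simp: abs_mult smoothed_nonneg smoothed_le B_nonneg intro!: mult_left_mono)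
    moreover have "(\<lambda>u. \<integral>z. norm (case (u, z) of (u, z) \<Rightarrow> ?F u z) \<partial>law_of_density k) = (\<lambda>u. \<bar>\<psi> u\<bar> * smoothed x h \<sigma> u)"
      by (simp add: smoothed_def abs_mult f_nonneg)
    ultimately show "integrable lborel (\<lambda>u. \<integral>z. norm (case (u, z) of (u, z) \<Rightarrow> ?F u z) \<partial>law_of_density k)"
      by simp
    show "AE u in lborel. integrable (law_of_density k) (\<lambda>z. case (u, z) of (u, z) \<Rightarrow> ?F u z)"
    proof (intro AE_I2)
      fix u
      show "integrable (law_of_density k) (\<lambda>z. case (u, z) of (u, z) \<Rightarrow> ?F u z)"
        using f_integrable_K[of "x - h * u" "- \<sigma>"] by simp
    qed
  qed measurable
  have inner: "(LBINT y. f y *\<^sub>R \<psi> ((x - (y + \<sigma> * z)) / h)) = h * (LBINT u. ?F u z)" for z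
    using h by (subst lborel_integral_real_affine[where c="- h" and t="x - \<sigma> * z"])
      (auto simp: algebra_simps)
  have "(\<integral>y. \<psi> ((x - y) / h) \<partial>noisy_law f k \<sigma>) = (\<integral>z. h * (LBINT u. ?F u z) \<partial>law_of_density k)"
    by (subst integral_noisy_law[where C=C]) (auto simp only: inner real_norm_def bound, measurable)
  also have "\<dots> = h * (\<integral>z. (LBINT u. ?F u z) \<partial>law_of_density k)"
    by simp
  also have "(\<integral>z. (LBINT u. ?F u z) \<partial>law_of_density k) = (LBINT u. \<integral>z. ?F u z \<partial>law_of_density k)"
    using LK.Fubini_integral[OF int] by simp
  also have "\<dots> = (LBINT u. \<psi> u * smoothed x h \<sigma> u)"
    by (simp add: smoothed_def)
  finally show ?thesis .
qed

end

section \<open>Limit of the second moment\<close>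

text \<open>Young's inequality with a weight \<open>\<delta> n\<close> replaces Cauchy-Schwarz: the
  difference of squares is at most \<open>(1 + 1 / \<delta> n)\<close> times the squared difference
  plus \<open>\<delta> n\<close> times the limiting square. A weight of the order of the distance
  makes both integrals vanish.\<close>

lemma L2_convergence_imp_squares_L1:
  fixes \<psi> :: "nat \<Rightarrow> real \<Rightarrow> real"
  assumes [measurable]: "\<And>n. \<psi> n \<in> borel_measurable lborel" "\<psi>' \<in> borel_measurable lborel"
    and int: "\<And>n. integrable lborel (\<lambda>u. (\<psi> n u)\<^sup>2)" and int': "integrable lborel (\<lambda>u. (\<psi>' u)\<^sup>2)"
    and conv: "(\<lambda>n. LBINT u. (\<psi> n u - \<psi>' u)\<^sup>2) \<longlonglongrightarrow> 0"
  shows "(\<lambda>n. LBINT u. \<bar>(\<psi> n u)\<^sup>2 - (\<psi>' u)\<^sup>2\<bar>) \<longlonglongrightarrow> 0"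
proof -
  define d where "d n = (LBINT u. (\<psi> n u - \<psi>' u)\<^sup>2)" for n
  define V where "V = (LBINT u. (\<psi>' u)\<^sup>2)"
  \<comment> \<open>The root gives \<open>d n / \<delta> n \<le> sqrt (d n)\<close>; the added
    \<open>1 / real (Suc n)\<close> keeps the weight positive when \<open>d n = 0\<close> and still
    tends to 0.\<close>
  define \<delta> where "\<delta> n = sqrt (d n) + 1 / real (Suc n)" for n
  have d0: "0 \<le> d n" for n
    unfolding d_def by simp
  have \<delta>: "0 < \<delta> n" "sqrt (d n) \<le> \<delta> n" for n
    using d0[of n] by (auto simp: \<delta>_def intro!: add_nonneg_pos)
  have intd: "integrable lborel (\<lambda>u. (\<psi> n u - \<psi>' u)\<^sup>2)" for n
  proof (rule Bochner_Integration.integrable_bound)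
    show "integrable lborel (\<lambda>u. 2 * (\<psi> n u)\<^sup>2 + 2 * (\<psi>' u)\<^sup>2)"
      using int int' by simp
    have "(a - b)\<^sup>2 \<le> 2 * a\<^sup>2 + 2 * b\<^sup>2" for a b :: real
      using zero_le_power2[of "a + b"] by (simp add: power2_sum power2_diff)
    then show "AE u in lborel. norm ((\<psi> n u - \<psi>' u)\<^sup>2) \<le> norm (2 * (\<psi> n u)\<^sup>2 + 2 * (\<psi>' u)\<^sup>2)"
      by auto
  qed measurable
  have "(\<lambda>n. sqrt (d n)) \<longlonglongrightarrow> sqrt 0"
    using conv unfolding d_def[symmetric] by (rule tendsto_real_sqrt)
  then have sd: "(\<lambda>n. sqrt (d n)) \<longlonglongrightarrow> 0" by simp
  have "\<delta> \<longlonglongrightarrow> 0 + 0"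
    unfolding \<delta>_def[abs_def] by (intro tendsto_add sd LIMSEQ_Suc[OF lim_1_over_n])
  then have "(\<lambda>n. d n + sqrt (d n) + \<delta> n * V) \<longlonglongrightarrow> 0 + 0 + 0 * V"
    using conv unfolding d_def[symmetric] by (intro tendsto_intros sd) auto
  then have lim: "(\<lambda>n. d n + sqrt (d n) + \<delta> n * V) \<longlonglongrightarrow> 0" by simp
  have bound: "(LBINT u. \<bar>(\<psi> n u)\<^sup>2 - (\<psi>' u)\<^sup>2\<bar>) \<le> d n + sqrt (d n) + \<delta> n * V" for n
  proof -
    have pw: "\<bar>a\<^sup>2 - b\<^sup>2\<bar> \<le> (1 + 1 / \<delta> n) * (a - b)\<^sup>2 + \<delta> n * b\<^sup>2" for a b :: real
    proof -
      have "2 * \<bar>(a - b) * b\<bar> \<le> (a - b)\<^sup>2 / \<delta> n + \<delta> n * b\<^sup>2"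
      proof -
        \<comment> \<open>Expanding this square is Young's inequality for the cross term
          \<open>2 * ((a - b) * b)\<close>.\<close>
        have "0 \<le> (\<bar>a - b\<bar> - \<delta> n * \<bar>b\<bar>)\<^sup>2 / \<delta> n"
          using \<delta>[of n] by simp
        also have "\<dots> = \<bar>a - b\<bar>\<^sup>2 / \<delta> n - 2 * (\<bar>a - b\<bar> * \<bar>b\<bar>) + \<delta> n * \<bar>b\<bar>\<^sup>2"
        proof -
          have "(p - \<delta> n * q)\<^sup>2 / \<delta> n = p\<^sup>2 / \<delta> n - 2 * (p * q) + \<delta> n * q\<^sup>2" for p q
            using \<delta>(1)[of n] by (simp add: field_simps power2_eq_square)
          then show ?thesis .
        qed
        also have "\<dots> = (a - b)\<^sup>2 / \<delta> n - 2 * \<bar>(a - b) * b\<bar> + \<delta> n * b\<^sup>2"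
          by (simp only: power2_abs abs_mult)
        finally show ?thesis by simp
      qed
      moreover have "\<bar>a\<^sup>2 - b\<^sup>2\<bar> \<le> (a - b)\<^sup>2 + 2 * \<bar>(a - b) * b\<bar>"
      proof -
        have "a\<^sup>2 - b\<^sup>2 = (a - b)\<^sup>2 + 2 * ((a - b) * b)"
          by (simp add: power2_eq_square algebra_simps)
        then have "\<bar>a\<^sup>2 - b\<^sup>2\<bar> \<le> \<bar>(a - b)\<^sup>2\<bar> + \<bar>2 * ((a - b) * b)\<bar>"
          by (metis abs_triangle_ineq)
        then show ?thesis by simp
      qed
      ultimately show ?thesis
        by (simp add: algebra_simps)
    qed
    have "(LBINT u. \<bar>(\<psi> n u)\<^sup>2 - (\<psi>' u)\<^sup>2\<bar>) \<le> (LBINT u. (1 + 1 / \<delta> n) * (\<psi> n u - \<psi>' u)\<^sup>2 + \<delta> n * (\<psi>' u)\<^sup>2)"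
      by (intro integral_mono integrable_abs Bochner_Integration.integrable_diff
          Bochner_Integration.integrable_add integrable_mult_right int int' intd pw)
    also have "\<dots> = (1 + 1 / \<delta> n) * d n + \<delta> n * V"
      using intd[of n] int' by (simp add: d_def V_def)
    also have "(1 + 1 / \<delta> n) * d n = d n + d n / \<delta> n"
      by (simp add: algebra_simps)
    also have "d n / \<delta> n \<le> sqrt (d n)"
    proof -
      have "d n = sqrt (d n) * sqrt (d n)"
        using d0 by simp
      also have "\<dots> \<le> sqrt (d n) * \<delta> n"
        using \<delta> d0 by (intro mult_left_mono) auto
      finally show ?thesis
        using \<delta>(1)[of n] by (simp add: divide_le_eq)
    qed
    finally show ?thesis by simp
  qed
  show ?thesis
    by (rule tendsto_sandwich[OF _ always_eventually tendsto_const lim]) (auto intro: bound)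
qed

text \<open>The two limits are separated. Since \<open>smoothed\<close> lies between 0 and
  \<open>B\<close>, replacing \<open>\<psi> n\<close> by \<open>\<psi>'\<close> costs at most
  \<open>B\<close> times the integrated difference of squares; with \<open>\<psi>'\<close> fixed,
  dominated convergence uses \<open>smoothed_tendsto\<close>.\<close>

lemma (in noisy_density) second_moment_tendsto:
  assumes [measurable]: "\<And>n. \<psi> n \<in> borel_measurable lborel" "\<psi>' \<in> borel_measurable lborel"
    and int: "\<And>n. integrable lborel (\<lambda>u. (\<psi> n u)\<^sup>2)" and int': "integrable lborel (\<lambda>u. (\<psi>' u)\<^sup>2)"
    and conv: "(\<lambda>n. LBINT u. (\<psi> n u - \<psi>' u)\<^sup>2) \<longlonglongrightarrow> 0"
    and h: "h \<longlonglongrightarrow> 0" and \<sigma>: "\<sigma> \<longlonglongrightarrow> 0"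
  shows "(\<lambda>n. LBINT u. (\<psi> n u)\<^sup>2 * smoothed x (h n) (\<sigma> n) u) \<longlonglongrightarrow> f x * (LBINT u. (\<psi>' u)\<^sup>2)"
proof -
  let ?G = "\<lambda>n u. smoothed x (h n) (\<sigma> n) u"
  have intG: "integrable lborel (\<lambda>u. g u * ?G n u)" if g: "integrable lborel g" for g n
  proof (rule Bochner_Integration.integrable_bound)
    show "integrable lborel (\<lambda>u. g u * B)"
      using g by simp
    show "(\<lambda>u. g u * ?G n u) \<in> borel_measurable lborel"
      using g by measurable
  qed (auto simp: abs_mult smoothed_nonneg smoothed_le B_nonneg intro!: mult_left_mono)
  have "(\<lambda>n. LBINT u. (\<psi>' u)\<^sup>2 * ?G n u) \<longlonglongrightarrow> (LBINT u. (\<psi>' u)\<^sup>2 * f x)"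
  proof (rule integral_dominated_convergence[where w="\<lambda>u. (\<psi>' u)\<^sup>2 * B"])
    show "integrable lborel (\<lambda>u. (\<psi>' u)\<^sup>2 * B)"
      using int' by simp
    show "AE u in lborel. (\<lambda>n. (\<psi>' u)\<^sup>2 * ?G n u) \<longlonglongrightarrow> (\<psi>' u)\<^sup>2 * f x"
      by (intro AE_I2 tendsto_mult tendsto_const smoothed_tendsto h \<sigma>)
  qed (auto simp: abs_mult smoothed_nonneg smoothed_le intro!: mult_left_mono)
  then have main: "(\<lambda>n. LBINT u. (\<psi>' u)\<^sup>2 * ?G n u) \<longlonglongrightarrow> f x * (LBINT u. (\<psi>' u)\<^sup>2)"
    by (simp add: mult.commute)
  have "(\<lambda>n. B * (LBINT u. \<bar>(\<psi> n u)\<^sup>2 - (\<psi>' u)\<^sup>2\<bar>)) \<longlonglongrightarrow> B * 0"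
    by (intro tendsto_mult tendsto_const L2_convergence_imp_squares_L1 int int' conv) measurable
  then have null: "(\<lambda>n. B * (LBINT u. \<bar>(\<psi> n u)\<^sup>2 - (\<psi>' u)\<^sup>2\<bar>)) \<longlonglongrightarrow> 0" by simp
  have "(\<lambda>n. (LBINT u. (\<psi> n u)\<^sup>2 * ?G n u) - (LBINT u. (\<psi>' u)\<^sup>2 * ?G n u)) \<longlonglongrightarrow> 0"
  proof (rule Lim_null_comparison[OF always_eventually null], rule allI)
    fix n
    have "(LBINT u. (\<psi> n u)\<^sup>2 * ?G n u) - (LBINT u. (\<psi>' u)\<^sup>2 * ?G n u)
        = (LBINT u. ((\<psi> n u)\<^sup>2 - (\<psi>' u)\<^sup>2) * ?G n u)"
      unfolding left_diff_distrib
      by (intro Bochner_Integration.integral_diff[symmetric] intG int int')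
    also have "norm \<dots> \<le> (LBINT u. B * \<bar>(\<psi> n u)\<^sup>2 - (\<psi>' u)\<^sup>2\<bar>)"
    proof (rule Bochner_Integration.integral_norm_bound_integral)
      show "integrable lborel (\<lambda>u. ((\<psi> n u)\<^sup>2 - (\<psi>' u)\<^sup>2) * ?G n u)"
        by (intro intG Bochner_Integration.integrable_diff int int')
      show "integrable lborel (\<lambda>u. B * \<bar>(\<psi> n u)\<^sup>2 - (\<psi>' u)\<^sup>2\<bar>)"
        by (intro integrable_mult_right integrable_abs Bochner_Integration.integrable_diff int int')
      show "norm (((\<psi> n u)\<^sup>2 - (\<psi>' u)\<^sup>2) * ?G n u) \<le> B * \<bar>(\<psi> n u)\<^sup>2 - (\<psi>' u)\<^sup>2\<bar>" for u
        using mult_left_mono[OF smoothed_le[of x "h n" "\<sigma> n" u] abs_ge_zero[of "(\<psi> n u)\<^sup>2 - (\<psi>' u)\<^sup>2"]]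
        by (simp add: abs_mult smoothed_nonneg mult.commute)
    qed
    finally show "norm ((LBINT u. (\<psi> n u)\<^sup>2 * ?G n u) - (LBINT u. (\<psi>' u)\<^sup>2 * ?G n u))
        \<le> B * (LBINT u. \<bar>(\<psi> n u)\<^sup>2 - (\<psi>' u)\<^sup>2\<bar>)"
      by simp
  qed
  from tendsto_add[OF this main] show ?thesis by simp
qed

section \<open>The estimator as a sum, and its mean\<close>

context deconvolution
begin

text \<open>Substituting \<open>t / h\<close> for \<open>t\<close> moves the bandwidth into the
  ratio \<open>\<sigma> / h\<close>; linearity in \<open>emp_char\<close> then splits the integral
  into kernel values. For \<open>n = 0\<close> both sides are 0, division by zero being 0.\<close>

lemma estimator_eq:
  assumes h: "0 < h"
  shows "deconv_estimator \<phi>w \<phi>k \<sigma> h n xs x = (\<Sum>j\<in>{1..n}. Re (W (\<sigma> / h) ((x - xs j) / h))) / (real n * h)"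
proof -
  let ?g = "\<lambda>t. iexp (- (t * x)) * (\<phi>w (h * t) * emp_char n xs t / \<phi>k (\<sigma> * t))"
  let ?s = "\<sigma> / h"
  have "(CLBINT t. ?g t) = (1 / h) *\<^sub>R (CLBINT t. ?g (0 + (1 / h) * t))"
    using h by (subst lborel_integral_real_affine[where c="1 / h" and t=0]) auto
  also have "(CLBINT t. ?g (0 + (1 / h) * t))
      = (CLBINT t. (\<Sum>j\<in>{1..n}. iexp (- (t * ((x - xs j) / h))) * Q ?s t) / of_nat n)"
  proof (intro Bochner_Integration.integral_cong refl)
    fix t
    have *: "iexp (- (t / h * x)) * iexp (t / h * xs j) = iexp (- (t * ((x - xs j) / h)))" for j
      by (simp add: exp_add[symmetric] algebra_simps diff_divide_distrib)
    have "?g (0 + (1 / h) * t) = (\<Sum>j\<in>{1..n}. (iexp (- (t / h * x)) * iexp (t / h * xs j)) * Q ?s t) / of_nat n"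
      using h by (simp add: emp_char_def Q_def sum_distrib_left sum_distrib_right sum_divide_distrib ac_simps)
    then show "?g (0 + (1 / h) * t) = (\<Sum>j\<in>{1..n}. iexp (- (t * ((x - xs j) / h))) * Q ?s t) / of_nat n"
      unfolding * .
  qed
  also have "\<dots> = (\<Sum>j\<in>{1..n}. fourier (Q ?s) ((x - xs j) / h)) / of_nat n"
    unfolding fourier_def integral_divide_zero
    by (subst Bochner_Integration.integral_sum) (rule integrable_iexp_mult(2)[OF Q_integrable] refl)+
  finally have "complex_of_real (1 / (2 * pi)) * (CLBINT t. ?g t)
      = (\<Sum>j\<in>{1..n}. W ?s ((x - xs j) / h)) / complex_of_real (real n * h)"
    by (simp add: W_eq scaleR_conv_of_real sum_divide_distrib ac_simps)
  then show ?thesis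
    unfolding deconv_estimator_def by (simp only: Re_divide_of_real Re_sum)
qed

text \<open>Fubini moves the expectation inside the Fourier integral, where it produces the
  characteristic function of the noisy law at \<open>t / h\<close>. Its factor
  \<open>\<phi>k\<close> cancels the denominator of \<open>Q\<close>, leaving
  \<open>\<phi>w t * char_of_density f (t / h)\<close>.\<close>

lemma mean_bound:
  assumes f: "noisy_density f k B" and \<phi>k: "\<phi>k = char_of_density k" and h: "0 < h"
    and int: "integrable lborel (char_of_density f)"
  shows "\<bar>\<integral>y. Re (W (\<sigma> / h) ((x - y) / h)) \<partial>noisy_law f k \<sigma>\<bar>
    \<le> h / (2 * pi) * (LBINT t. norm (char_of_density f t))"
proof -
  interpret noisy_density f k B by (rule f)
  let ?s = "\<sigma> / h" and ?N = "noisy_law f k \<sigma>"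
  interpret N: real_distribution ?N
    by (rule noisy_law_real_distribution)
  interpret LN: pair_sigma_finite lborel ?N ..
  let ?F = "\<lambda>t y. iexp (- (t * ((x - y) / h))) * Q ?s t"
  have intF: "integrable (lborel \<Otimes>\<^sub>M ?N) (\<lambda>(t, y). ?F t y)"
  proof (rule LN.Fubini_integrable)
    have "(\<lambda>t. \<integral>y. norm (case (t, y) of (t, y) \<Rightarrow> ?F t y) \<partial>?N) = (\<lambda>t. norm (Q ?s t))"
      using N.prob_space by (simp add: norm_mult)
    then show "integrable lborel (\<lambda>t. \<integral>y. norm (case (t, y) of (t, y) \<Rightarrow> ?F t y) \<partial>?N)"
      using Q_integrable by simp
    show "AE t in lborel. integrable ?N (\<lambda>y. case (t, y) of (t, y) \<Rightarrow> ?F t y)"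
      by (intro AE_I2 N.integrable_const_bound[where B="norm (Q ?s _)"]) (auto simp: norm_mult)
  qed measurable
  have inner: "(\<integral>y. ?F t y \<partial>?N) = iexp (- (t * x / h)) * (\<phi>w t * char_of_density f (t / h))" for t
  proof -
    have "(\<integral>y. ?F t y \<partial>?N) = (\<integral>y. (iexp (- (t * x / h)) * Q ?s t) * iexp ((t / h) * y) \<partial>?N)"
    proof (intro Bochner_Integration.integral_cong refl)
      fix y
      have "iexp (- (t * ((x - y) / h))) = iexp (- (t * x / h)) * iexp ((t / h) * y)"
        by (simp add: exp_add[symmetric] algebra_simps diff_divide_distrib)
      then show "?F t y = (iexp (- (t * x / h)) * Q ?s t) * iexp ((t / h) * y)"
        by (simp only: ac_simps)
    qed
    also have "\<dots> = (iexp (- (t * x / h)) * Q ?s t) * char ?N (t / h)"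
      unfolding char_def by (rule integral_mult_right_zero)
    also have "\<dots> = iexp (- (t * x / h)) * (Q ?s t * \<phi>k (?s * t)) * char_of_density f (t / h)"
      by (simp add: char_noisy_law \<phi>k ac_simps)
    also have "Q ?s t * \<phi>k (?s * t) = \<phi>w t"
      by (simp add: Q_def \<phi>k_nonzero)
    finally show ?thesis by (simp only: mult.assoc)
  qed
  have intW: "integrable ?N (\<lambda>y. W ?s ((x - y) / h))"
  proof -
    obtain K where K: "\<And>u. norm (W ?s u) \<le> K"
      using W_bound[of "\<bar>?s\<bar>"] by (metis order_refl)
    show ?thesis
      by (rule N.integrable_const_bound[where B=K]) (auto simp: K)
  qed
  have "(\<integral>y. W ?s ((x - y) / h) \<partial>?N) = complex_of_real (1 / (2 * pi)) * (\<integral>y. (CLBINT t. ?F t y) \<partial>?N)"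
    unfolding W_eq fourier_def by (rule integral_mult_right_zero)
  also have "(\<integral>y. (CLBINT t. ?F t y) \<partial>?N) = (CLBINT t. \<integral>y. ?F t y \<partial>?N)"
    by (rule LN.Fubini_integral[OF intF])
  also have "\<dots> = (CLBINT t. iexp (- (t * x / h)) * (\<phi>w t * char_of_density f (t / h)))"
    unfolding inner ..
  finally have eq: "(\<integral>y. W ?s ((x - y) / h) \<partial>?N)
    = complex_of_real (1 / (2 * pi)) * (CLBINT t. iexp (- (t * x / h)) * (\<phi>w t * char_of_density f (t / h)))" .
  have [measurable]: "char_of_density f \<in> borel_measurable borel"
    using int by simp
  have int_h: "integrable lborel (\<lambda>t. norm (char_of_density f (t / h)))"
    using lborel_integrable_real_affine[OF int, of "1 / h" 0] h by simp
  have le: "norm (iexp (- (t * x / h)) * (\<phi>w t * char_of_density f (t / h))) \<le> norm (char_of_density f (t / h))" for t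
    using mult_right_mono[OF \<phi>w_le norm_ge_zero, of t "char_of_density f (t / h)"] by (simp add: norm_mult)
  have "norm (CLBINT t. iexp (- (t * x / h)) * (\<phi>w t * char_of_density f (t / h)))
      \<le> (LBINT t. norm (char_of_density f (t / h)))"
  proof (rule Bochner_Integration.integral_norm_bound_integral[OF _ int_h le])
    show "integrable lborel (\<lambda>t. iexp (- (t * x / h)) * (\<phi>w t * char_of_density f (t / h)))"
      by (rule Bochner_Integration.integrable_bound[OF int_h])
         (measurable, intro AE_I2 order_trans[OF le], simp)
  qed
  \<comment> \<open>The factor \<open>h\<close> arises here, from undoing the argument
    \<open>t / h\<close>.\<close>
  also have "\<dots> = h * (LBINT t. norm (char_of_density f t))"
    using h by (subst lborel_integral_real_affine[where c=h and t=0]) auto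
  finally have "norm (\<integral>y. W ?s ((x - y) / h) \<partial>?N) \<le> h / (2 * pi) * (LBINT t. norm (char_of_density f t))"
    unfolding eq norm_mult norm_of_real by (simp add: divide_right_mono)
  moreover have "(\<integral>y. Re (W ?s ((x - y) / h)) \<partial>?N) = Re (\<integral>y. W ?s ((x - y) / h) \<partial>?N)"
    using intW by simp
  ultimately show ?thesis
    using abs_Re_le_cmod order_trans by metis
qed

end

section \<open>Asymptotic normality of the deconvolution estimator\<close>

text \<open>Joint independence of both families is stated over the disjoint sum of two copies of the
  index set. The disjoint blocks \<open>{Inl j, Inr j}\<close> give independence of the
  observations, the singletons \<open>{Inl j}\<close> and \<open>{Inr j}\<close> that of signal and
  noise.\<close>

lemma (in prob_space) indep_vars_add_noise:
  fixes Y Z :: "'i \<Rightarrow> 'a \<Rightarrow> real"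
  assumes indep: "indep_vars (\<lambda>_. borel) (case_sum Y Z) (J <+> J)"
  shows "indep_vars (\<lambda>_. borel) (\<lambda>j \<omega>. Y j \<omega> + \<sigma> * Z j \<omega>) J"
    and "j \<in> J \<Longrightarrow> indep_var borel (Y j) borel (Z j)"
proof -
  have "indep_vars (\<lambda>j. PiM {Inl j, Inr j} (\<lambda>_. borel))
      (\<lambda>j \<omega>. restrict (\<lambda>i. case_sum Y Z i \<omega>) {Inl j, Inr j}) J"
    by (rule indep_vars_restrict[OF indep]) (auto simp: disjoint_family_on_def)
  then have "indep_vars (\<lambda>_. borel)
      (\<lambda>j \<omega>. (\<lambda>g. g (Inl j) + \<sigma> * g (Inr j)) (restrict (\<lambda>i. case_sum Y Z i \<omega>) {Inl j, Inr j})) J"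
    by (rule indep_vars_compose2) measurable
  then show "indep_vars (\<lambda>_. borel) (\<lambda>j \<omega>. Y j \<omega> + \<sigma> * Z j \<omega>) J"
    by simp
  assume j: "j \<in> J"
  have "indep_var borel
      ((\<lambda>g. g (Inl j)) \<circ> (\<lambda>\<omega>. restrict (\<lambda>i. case_sum Y Z i \<omega>) {Inl j})) borel
      ((\<lambda>g. g (Inr j)) \<circ> (\<lambda>\<omega>. restrict (\<lambda>i. case_sum Y Z i \<omega>) {Inr j}))"
    by (rule indep_var_compose[OF indep_var_restrict[OF indep]]) (use j in \<open>auto\<close>)
  then show "indep_var borel (Y j) borel (Z j)"
    by (simp add: comp_def)
qed

theorem theorem1:
  fixes M :: "nat \<Rightarrow> 'a measure"
    and X Y Z :: "nat \<Rightarrow> nat \<Rightarrow> 'a \<Rightarrow> real"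
    and f k w :: "real \<Rightarrow> real"
    and \<phi>w :: "real \<Rightarrow> complex"
    and h \<sigma> :: "nat \<Rightarrow> real"
    and r x :: real
  assumes prob: "\<And>n. prob_space (M n)"
    and dens_Y: "\<And>n j. j \<in> {1..n} \<Longrightarrow> distributed (M n) lborel (Y n j) (\<lambda>y. ennreal (f y))"
    and dens_Z: "\<And>n j. j \<in> {1..n} \<Longrightarrow> distributed (M n) lborel (Z n j) (\<lambda>z. ennreal (k z))"
    and indep: "\<And>n. prob_space.indep_vars (M n) (\<lambda>_. borel) (case_sum (Y n) (Z n)) ({1..n} <+> {1..n})"
    and X_eq: "\<And>n j \<omega>. X n j \<omega> = Y n j \<omega> + \<sigma> n * Z n j \<omega>"
    and f_dens: "prob_density f"
    and k_dens: "prob_density k"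
    and h_pos: "\<And>n. 0 < h n"
    and \<sigma>_nonneg: "\<And>n. 0 \<le> \<sigma> n"
    and \<phi>f_integrable: "integrable lborel (char_of_density f)"
    and f_cont: "continuous_on UNIV f"
    and \<phi>k_nonzero: "\<And>t. char_of_density k t \<noteq> 0"
    and \<phi>k_diff: "\<And>t. char_of_density k differentiable at t"
    and \<phi>k_deriv_bounded: "bounded (range (\<lambda>t. vector_derivative (char_of_density k) (at t)))"
    and w_fourier: "\<And>u. complex_of_real (w u) =
          complex_of_real (1 / (2 * pi)) * (CLBINT t. iexp (- (t * u)) * \<phi>w t)"
    and w_symmetric: "\<And>u. w (- u) = w u"
    and w_bounded: "bounded (range w)"
    and w_cont: "continuous_on UNIV w"
    and \<phi>w_support: "closure {t. \<phi>w t \<noteq> 0} = {- 1..1}"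
    and \<phi>w_0: "\<phi>w 0 = 1"
    and \<phi>w_diff: "\<And>t. \<phi>w differentiable at t"
    and \<phi>w_le_1: "\<And>t. norm (\<phi>w t) \<le> 1"
    and h_lim: "h \<longlonglongrightarrow> 0"
    and nh_lim: "filterlim (\<lambda>n. real n * h n) at_top sequentially"
    and \<sigma>_lim: "\<sigma> \<longlonglongrightarrow> 0"
    and r_nonneg: "0 \<le> r"
    and r_lim: "(\<lambda>n. \<sigma> n / h n) \<longlonglongrightarrow> r"
  shows "weak_conv_m
    (\<lambda>n. distr (M n) borel (\<lambda>\<omega>. sqrt (real n * h n) *
       (deconv_estimator \<phi>w (char_of_density k) (\<sigma> n) (h n) n (\<lambda>j. X n j \<omega>) x
        - prob_space.expectation (M n)
            (\<lambda>\<omega>'. deconv_estimator \<phi>w (char_of_density k) (\<sigma> n) (h n) n (\<lambda>j. X n j \<omega>') x))))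
    (normal_law 0 (f x * (LBINT u. (cmod (deconv_kernel \<phi>w (char_of_density k) r u))\<^sup>2)))"
proof -
  let ?\<phi>k = "char_of_density k"
  have \<phi>w_cont: "continuous_on UNIV \<phi>w"
    using \<phi>w_diff by (auto intro!: continuous_at_imp_continuous_on differentiable_imp_continuous_within)
  have \<phi>w_supp: "\<phi>w t = 0" if "1 < \<bar>t\<bar>" for t
  proof (rule ccontr)
    assume "\<phi>w t \<noteq> 0"
    then have "t \<in> closure {t. \<phi>w t \<noteq> 0}"
      by (intro subsetD[OF closure_subset]) simp
    then show False
      using that unfolding \<phi>w_support by auto
  qed
  have [measurable]: "\<phi>w \<in> borel_measurable borel"
    using \<phi>w_cont by (rule borel_measurable_continuous_onI)
  have \<phi>w_int: "integrable lborel \<phi>w"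
  proof (rule Bochner_Integration.integrable_bound)
    show "integrable lborel (\<lambda>t::real. indicator {-1..1} t :: real)"
      by simp
    show "AE t in lborel. norm (\<phi>w t) \<le> norm (indicator {-1..1} t :: real)"
      using \<phi>w_le_1 \<phi>w_supp by (auto simp: indicator_def abs_le_iff not_le)
  qed simp
  \<comment> \<open>As \<open>w\<close> is real, \<open>\<phi>w\<close> and its conjugate reflection
    have the same transform \<open>2 * pi * w u\<close>; uniqueness for continuous integrable
    functions identifies them.\<close>
  have \<phi>w_cnj: "\<phi>w (- t) = cnj (\<phi>w t)" for t
  proof -
    have reflect_int: "integrable lborel (\<lambda>t. cnj (\<phi>w (- t)))"
      using lborel_integrable_real_affine[OF \<phi>w_int, of "-1" 0] by simp
    have "\<phi>w t - cnj (\<phi>w (- t)) = 0" for t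
    proof (rule fourier_eq_0_imp_eq_0[where B=2 and g="\<lambda>t. \<phi>w t - cnj (\<phi>w (- t))"])
      show "integrable lborel (\<lambda>t. \<phi>w t - cnj (\<phi>w (- t)))"
        by (intro Bochner_Integration.integrable_diff \<phi>w_int reflect_int)
      show "continuous_on UNIV (\<lambda>t. \<phi>w t - cnj (\<phi>w (- t)))"
        by (intro continuous_intros \<phi>w_cont continuous_on_compose2[OF \<phi>w_cont]) auto
      show "norm (\<phi>w t - cnj (\<phi>w (- t))) \<le> 2" for t
        using norm_triangle_ineq4[of "\<phi>w t" "cnj (\<phi>w (- t))"] \<phi>w_le_1[of t] \<phi>w_le_1[of "- t"] by simp
      fix u
      have w: "fourier \<phi>w u = complex_of_real (2 * pi * w u)"
        using w_fourier[of u] by (simp add: fourier_def field_simps)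
      have "fourier (\<lambda>t. cnj (\<phi>w (- t))) u = \<bar>-1\<bar> *\<^sub>R (CLBINT t. iexp (- ((0 + (-1) * t) * u)) * cnj (\<phi>w (- (0 + (-1) * t))))"
        unfolding fourier_def by (rule lborel_integral_real_affine) simp
      also have "\<dots> = (CLBINT t. cnj (iexp (- (t * u)) * \<phi>w t))"
        by (simp add: exp_cnj)
      also have "\<dots> = cnj (fourier \<phi>w u)"
        unfolding fourier_def by (rule Bochner_Integration.integral_cnj)
      also have "\<dots> = fourier \<phi>w u"
        unfolding w by simp
      finally have reflect: "fourier (\<lambda>t. cnj (\<phi>w (- t))) u = fourier \<phi>w u" .
      have "fourier (\<lambda>t. \<phi>w t - cnj (\<phi>w (- t))) u = fourier \<phi>w u - fourier (\<lambda>t. cnj (\<phi>w (- t))) u"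
        unfolding fourier_def right_diff_distrib
        by (rule Bochner_Integration.integral_diff)
           (rule integrable_iexp_mult(2)[OF \<phi>w_int] integrable_iexp_mult(2)[OF reflect_int])+
      then show "fourier (\<lambda>t. \<phi>w t - cnj (\<phi>w (- t))) u = 0"
        unfolding reflect by simp
    qed
    from this[of t] have "\<phi>w t = cnj (\<phi>w (- t))" by simp
    then show ?thesis by simp
  qed
  interpret deconvolution \<phi>w ?\<phi>k
    using \<phi>w_cont \<phi>w_supp \<phi>w_le_1 \<phi>w_cnj char_of_density_continuous[OF k_dens] \<phi>k_nonzero char_of_density_cnj
    by unfold_locales
  define B where "B = (LBINT t. norm (char_of_density f t)) / (2 * pi)"
  interpret noisy_density f k B
    using f_dens k_dens f_cont density_bounded_by_char[OF f_dens f_cont \<phi>f_integrable]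
    unfolding B_def by unfold_locales
  define s where "s n = \<sigma> n / h n" for n
  define \<psi> where "\<psi> n u = Re (W (s n) u)" for n u
  define N where "N n = noisy_law f k (\<sigma> n)" for n
  define m where "m n = (\<integral>y. \<psi> n ((x - y) / h n) \<partial>N n)" for n
  define v where "v = f x * (LBINT u. (cmod (W r u))\<^sup>2)"
  \<comment> \<open>The estimator carries \<open>1 / (n * h n)\<close>; multiplied by the
    normalisation \<open>sqrt (n * h n)\<close> it leaves the reciprocal root.\<close>
  define \<xi> where "\<xi> n y = (\<psi> n ((x - y) / h n) - m n) / sqrt (real n * h n)" for n y
  have s_lim: "s \<longlonglongrightarrow> r"
    using r_lim unfolding s_def .
  obtain K where K: "0 < K" "\<And>n u. \<bar>\<psi> n u\<bar> \<le> K"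
  proof -
    obtain R where R: "\<And>n. norm (s n) \<le> R"
      using convergent_imp_Bseq[of s] s_lim unfolding convergent_def Bseq_def by auto
    obtain K where "0 < K" "\<And>s u. \<bar>s\<bar> \<le> R \<Longrightarrow> norm (W s u) \<le> K"
      using W_bound by metis
    then show thesis
      using R by (intro that[of K]) (auto simp: \<psi>_def intro: order_trans[OF abs_Re_le_cmod])
  qed
  have \<psi>_measurable [measurable]: "\<psi> n \<in> borel_measurable borel" for n
    unfolding \<psi>_def[abs_def] by measurable
  have \<xi>_measurable [measurable]: "\<xi> n \<in> borel_measurable borel" for n
    unfolding \<xi>_def[abs_def] by measurable
  have N: "real_distribution (N n)" for n
    unfolding N_def by (rule noisy_law_real_distribution)
  have m_le: "\<bar>m n\<bar> \<le> K" for n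
  proof -
    interpret real_distribution "N n" by (rule N)
    have int: "integrable (N n) (\<lambda>y. \<psi> n ((x - y) / h n))"
      by (rule integrable_const_bound[where B=K]) (auto simp: K N_def)
    have "\<bar>m n\<bar> \<le> (\<integral>y. K \<partial>N n)"
      unfolding m_def by (rule integral_abs_bound_integral[OF int]) (auto simp: K)
    then show ?thesis
      using prob_space by simp
  qed
  have X_law: "distr (M n) borel (X n j) = N n" if "j \<in> {1..n}" for n j
  proof -
    interpret prob_space "M n" by (rule prob)
    have "X n j = (\<lambda>\<omega>. Y n j \<omega> + \<sigma> n * Z n j \<omega>)"
      using X_eq by auto
    then show ?thesis
      using distr_add_noise[OF dens_Y[OF that] dens_Z[OF that] indep_vars_add_noise(2)[OF indep that]]
      by (simp add: N_def)
  qed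
  have X_indep: "prob_space.indep_vars (M n) (\<lambda>_. borel) (X n) {1..n}" for n
  proof -
    interpret prob_space "M n" by (rule prob)
    have "X n = (\<lambda>j \<omega>. Y n j \<omega> + \<sigma> n * Z n j \<omega>)"
      using X_eq by (intro ext)
    then show ?thesis
      using indep_vars_add_noise(1)[OF indep] by simp
  qed
  have X_measurable: "X n j \<in> borel_measurable (M n)" if "j \<in> {1..n}" for n j
  proof -
    interpret prob_space "M n" by (rule prob)
    show ?thesis
      using X_indep[of n] that unfolding indep_vars_def by auto
  qed
  have second_moment: "(1 / h n) * (\<integral>y. (\<psi> n ((x - y) / h n))\<^sup>2 \<partial>N n)
      = (LBINT u. (\<psi> n u)\<^sup>2 * smoothed x (h n) (\<sigma> n) u)" for n
  proof -
    have "\<bar>(\<psi> n u)\<^sup>2\<bar> \<le> K\<^sup>2" for u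
      using power_mono[OF K(2) abs_ge_zero, of _ _ 2] by simp
    then show ?thesis
      using integral_noisy_law_rescaled[OF W_square_integrable, of "s n" "K\<^sup>2" "h n" "\<sigma> n" x] h_pos[of n]
      by (simp add: \<psi>_def N_def)
  qed
  have second_moment_lim: "(\<lambda>n. (1 / h n) * (\<integral>y. (\<psi> n ((x - y) / h n))\<^sup>2 \<partial>N n)) \<longlonglongrightarrow> v"
  proof -
    have "(cmod (W r u))\<^sup>2 = (Re (W r u))\<^sup>2" for u
      using Im_W by (simp add: cmod_def)
    then have "v = f x * (LBINT u. (Re (W r u))\<^sup>2)"
      by (simp add: v_def)
    moreover have "(\<lambda>n. LBINT u. (\<psi> n u)\<^sup>2 * smoothed x (h n) (\<sigma> n) u) \<longlonglongrightarrow> f x * (LBINT u. (Re (W r u))\<^sup>2)"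
      unfolding \<psi>_def
      by (intro second_moment_tendsto W_square_integrable W_L2_convergence s_lim h_lim \<sigma>_lim) measurable
    ultimately show ?thesis
      by (simp only: second_moment)
  qed
  \<comment> \<open>The bound \<open>m_le\<close> would be too weak after division by
    \<open>h n\<close>. By \<open>mean_bound\<close>, whose constant is again \<open>B\<close>, the
    quotient is at most \<open>h n * B\<^sup>2\<close>.\<close>
  have mean_lim: "(\<lambda>n. (m n)\<^sup>2 / h n) \<longlonglongrightarrow> 0"
  proof -
    have le: "(m n)\<^sup>2 / h n \<le> h n * B\<^sup>2" for n
    proof -
      have "\<bar>m n\<bar> \<le> h n / (2 * pi) * (LBINT t. norm (char_of_density f t))"
        unfolding m_def \<psi>_def s_def N_def
        by (rule mean_bound[OF noisy_density_axioms refl h_pos \<phi>f_integrable])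
      then have "\<bar>m n\<bar> \<le> h n * B"
        by (simp add: B_def)
      then have "\<bar>m n\<bar>\<^sup>2 \<le> (h n * B)\<^sup>2"
        by (intro power_mono) auto
      then have "(m n)\<^sup>2 \<le> (h n * B\<^sup>2) * h n"
        by (simp add: power2_eq_square ac_simps)
      then show ?thesis
        using h_pos[of n] by (simp only: pos_divide_le_eq)
    qed
    have nonneg: "0 \<le> (m n)\<^sup>2 / h n" for n
      using h_pos[of n] by simp
    show ?thesis
      by (rule tendsto_sandwich[OF always_eventually always_eventually tendsto_const
            tendsto_mult_left_zero[OF h_lim]])
         (use nonneg le in auto)
  qed
  \<comment> \<open>In the bound \<open>b\<close> the constant is \<open>2 * K\<close> because the
    kernel value and its mean \<open>m n\<close> are each at most \<open>K\<close>.\<close>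
  have "weak_conv_m (\<lambda>n. distr (M n) borel (\<lambda>\<omega>. \<Sum>j\<in>{1..n}. \<xi> n (X n j \<omega>))) (normal_law 0 v)"
  proof (rule bounded_triangular_array_clt[where \<mu>="\<lambda>n. distr (N n) borel (\<xi> n)" and b="\<lambda>n. 2 * K / sqrt (real n * h n)"])
    show "prob_space (M n)" for n
      by (rule prob)
    show "prob_space.indep_vars (M n) (\<lambda>_. borel) (\<lambda>j \<omega>. \<xi> n (X n j \<omega>)) {1..n}" for n
      by (rule prob_space.indep_vars_compose2[OF prob X_indep]) measurable
    show "distr (M n) borel (\<lambda>\<omega>. \<xi> n (X n j \<omega>)) = distr (N n) borel (\<xi> n)" if "j \<in> {1..n}" for n j
      unfolding X_law[OF that, symmetric]
      by (subst distr_distr) (auto simp: comp_def X_measurable[OF that])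
    show "real_distribution (distr (N n) borel (\<xi> n))" for n
    proof -
      interpret real_distribution "N n" by (rule N)
      show ?thesis by (rule real_distribution_distr) (simp add: N_def)
    qed
    show "AE y in distr (N n) borel (\<xi> n). \<bar>y\<bar> \<le> 2 * K / sqrt (real n * h n)" for n
    proof -
      have "\<bar>\<xi> n y\<bar> \<le> 2 * K / sqrt (real n * h n)" for y
        using K(2)[of n "(x - y) / h n"] m_le[of n] h_pos[of n]
        by (auto simp: \<xi>_def abs_divide intro!: divide_right_mono)
      then show ?thesis
        by (subst AE_distr_iff) (auto simp: N_def)
    qed
    have moments: "(\<integral>y. y \<partial>distr (N n) borel (\<xi> n)) = 0"
      "(\<integral>y. y\<^sup>2 \<partial>distr (N n) borel (\<xi> n))
        = ((\<integral>y. (\<psi> n ((x - y) / h n))\<^sup>2 \<partial>N n) - (m n)\<^sup>2) / (real n * h n)" for n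
    proof -
      interpret real_distribution "N n" by (rule N)
      have int: "integrable (N n) (\<lambda>y. \<psi> n ((x - y) / h n))"
        by (rule integrable_const_bound[where B=K]) (auto simp: K N_def)
      have int2: "integrable (N n) (\<lambda>y. (\<psi> n ((x - y) / h n))\<^sup>2)"
      proof (rule integrable_const_bound[where B="K\<^sup>2"])
        show "AE y in N n. norm ((\<psi> n ((x - y) / h n))\<^sup>2) \<le> K\<^sup>2"
          using power_mono[OF K(2) abs_ge_zero, of _ _ 2] by (intro AE_I2) simp
      qed (simp add: N_def)
      have "(\<integral>y. y \<partial>distr (N n) borel (\<xi> n)) = (\<integral>y. \<psi> n ((x - y) / h n) - m n \<partial>N n) / sqrt (real n * h n)"
        unfolding integral_divide_zero[symmetric] by (subst integral_distr) (auto simp: \<xi>_def[abs_def] N_def)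
      also have "\<dots> = 0"
        using int prob_space by (simp add: m_def)
      finally show "(\<integral>y. y \<partial>distr (N n) borel (\<xi> n)) = 0" .
      have "(\<integral>y. y\<^sup>2 \<partial>distr (N n) borel (\<xi> n))
          = (\<integral>y. (\<psi> n ((x - y) / h n) - m n)\<^sup>2 \<partial>N n) / (real n * h n)"
        using h_pos[of n] by (subst integral_distr) (auto simp: \<xi>_def[abs_def] N_def power_divide)
      also have "(\<integral>y. (\<psi> n ((x - y) / h n) - m n)\<^sup>2 \<partial>N n) = (\<integral>y. (\<psi> n ((x - y) / h n))\<^sup>2 \<partial>N n) - (m n)\<^sup>2"
        unfolding m_def by (rule variance_eq[OF int int2])
      finally show "(\<integral>y. y\<^sup>2 \<partial>distr (N n) borel (\<xi> n))
        = ((\<integral>y. (\<psi> n ((x - y) / h n))\<^sup>2 \<partial>N n) - (m n)\<^sup>2) / (real n * h n)" .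
    qed
    show "(\<integral>y. y \<partial>distr (N n) borel (\<xi> n)) = 0" for n
      by (rule moments)
    have "(\<lambda>n. (1 / h n) * (\<integral>y. (\<psi> n ((x - y) / h n))\<^sup>2 \<partial>N n) - (m n)\<^sup>2 / h n) \<longlonglongrightarrow> v - 0"
      by (intro tendsto_diff second_moment_lim mean_lim)
    \<comment> \<open>For positive \<open>n\<close> the factor \<open>n\<close> cancels, so
      \<open>n\<close> times the variance of a summand is the rescaled second moment minus the
      negligible squared mean.\<close>
    moreover have "\<forall>\<^sub>F n in sequentially. (1 / h n) * (\<integral>y. (\<psi> n ((x - y) / h n))\<^sup>2 \<partial>N n) - (m n)\<^sup>2 / h n
        = real n * (\<integral>y. y\<^sup>2 \<partial>distr (N n) borel (\<xi> n))"
      using eventually_gt_at_top[of 0]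
    proof eventually_elim
      case (elim n)
      then show ?case
        using h_pos[of n] by (simp add: moments diff_divide_distrib right_diff_distrib)
    qed
    ultimately show "(\<lambda>n. real n * (\<integral>y. y\<^sup>2 \<partial>distr (N n) borel (\<xi> n))) \<longlonglongrightarrow> v"
      by (simp add: tendsto_cong)
    have "filterlim (\<lambda>n. sqrt (real n * h n)) at_top sequentially"
      using nh_lim by (rule filterlim_compose[OF sqrt_at_top])
    then show "(\<lambda>n. 2 * K / sqrt (real n * h n)) \<longlonglongrightarrow> 0"
      by (intro tendsto_divide_0[OF tendsto_const] filterlim_at_top_imp_at_infinity)
  qed
  moreover have "(\<lambda>\<omega>. \<Sum>j\<in>{1..n}. \<xi> n (X n j \<omega>)) = (\<lambda>\<omega>. sqrt (real n * h n) *
       (deconv_estimator \<phi>w ?\<phi>k (\<sigma> n) (h n) n (\<lambda>j. X n j \<omega>) x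
        - prob_space.expectation (M n)
            (\<lambda>\<omega>'. deconv_estimator \<phi>w ?\<phi>k (\<sigma> n) (h n) n (\<lambda>j. X n j \<omega>') x)))" for n
  proof -
    interpret prob_space "M n" by (rule prob)
    have est: "deconv_estimator \<phi>w ?\<phi>k (\<sigma> n) (h n) n xs x
        = (\<Sum>j\<in>{1..n}. \<psi> n ((x - xs j) / h n)) / (real n * h n)" for xs
      unfolding \<psi>_def s_def by (rule estimator_eq[OF h_pos])
    have int: "integrable (M n) (\<lambda>\<omega>. \<psi> n ((x - X n j \<omega>) / h n))" if "j \<in> {1..n}" for j
      using X_measurable[OF that] by (intro integrable_const_bound[where B=K]) (auto simp: K)
    have mean: "expectation (\<lambda>\<omega>. \<psi> n ((x - X n j \<omega>) / h n)) = m n" if "j \<in> {1..n}" for j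
      unfolding m_def X_law[OF that, symmetric]
      using X_measurable[OF that] by (subst integral_distr) auto
    have "expectation (\<lambda>\<omega>'. deconv_estimator \<phi>w ?\<phi>k (\<sigma> n) (h n) n (\<lambda>j. X n j \<omega>') x)
        = (\<Sum>j\<in>{1..n}. m n) / (real n * h n)"
      unfolding est integral_divide_zero
      by (subst Bochner_Integration.integral_sum) (simp_all only: int mean cong: sum.cong)
    moreover have "sqrt (real n * h n) * (a / (real n * h n) - b / (real n * h n)) = (a - b) / sqrt (real n * h n)" for a b
    proof -
      \<comment> \<open>With \<open>d\<close> the root of \<open>n * h n\<close>;
        \<open>d = 0\<close> is covered too, so the identity of random variables holds for
        \<open>n = 0\<close> as well.\<close>
      have *: "d * (a / (d * d) - b / (d * d)) = (a - b) / d" for d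
        by (simp add: diff_divide_distrib right_diff_distrib)
      show ?thesis
        using *[of "sqrt (real n * h n)"] h_pos[of n]
        by (simp only: real_sqrt_mult_self abs_of_nonneg mult_nonneg_nonneg of_nat_0_le_iff less_imp_le)
    qed
    ultimately show ?thesis
      unfolding est by (simp only: \<xi>_def sum_subtractf sum_divide_distrib[symmetric])
  qed
  ultimately show ?thesis
    unfolding v_def by simp
qed

end
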